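(* Let $A,B$ be any fixed real numbers, $\lambda>0$ and $s\in\mathbb N$. Let ${\bf a}=\{a_k\}_{k=1}^\infty$ be a fixed system of points in the open upper half-plane $\mathbb C_+$, let $\rho_0\neq 0$ be a constant, and put $\rho_n(z)=\rho_0\prod_{k=1}^n(z-a_k)$. Let $P_{n-1}$ be the set of all algebraic polynomials with complex coefficients of degree at most $n-1$, and let $$\mathcal E_n:=\inf_{p\in P_{n-1}}\left(\int_{-\infty}^{\infty}\left|\frac{A+Bt}{(t^2+\lambda^2)^{s+1}}-p(t)\right|^2\frac{dt}{|\rho_n(t)|^2}\right)^{1/2}.$$ Then for any $n\in\mathbb N$ $$\mathcal E_n^2=\frac{4\pi}{(2\lambda)^{2s+3}\,|\rho_n(-\mathrm i\lambda)|^2}\sum_{k=0}^{s}\sum_{l=0}^{s}\binom{l+k}{l}G_k\overline{G_l},$$ where $$G_k=\sum_{j=0}^{s-k}\frac{\binom{s+j}{s}\,\mathrm i^{\,s-k-j}\,\nu_{s-k-j}(\mathrm i\lambda,\bar{\bf a})}{(2\lambda)^{k+j}}\left(\frac{B\lambda\,(s(s+j)-2j)}{s(s+j)}-\mathrm iA\right).$$ The infimum defining $\mathcal E_n$ is attained for the polynomial $p_{n-1}^{(\lambda,s)}(z)=\tau_n(z,\bar{\bf a})\,S_n(R_{n,s}^\lambda)(z)$.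
   Context: Notation. $\mathbb C_+=\{z\in\mathbb C:\operatorname{Im}z>0\}$; $\bar{\bf a}=\{\overline{a_k}\}_{k=1}^\infty$; for a sequence ${\bf c}=\{c_k\}$ and fixed $n$, $\tau_n(z,{\bf c})=\prod_{k=1}^n(z-c_k)$, and for integers $m\ge 0$ $$\nu_m(z,{\bf c})=\sum_{k_1+\cdots+k_n=m}\ \prod_{j=1}^n\frac1{(z-c_j)^{k_j}},$$ the sum being over all vectors $(k_1,\ldots,k_n)$ with non-negative integer coordinates whose sum is $m$. The Takenaka–Malmquist type system on the real line is $$\Phi_j(z)=\frac{\sqrt{\operatorname{Im}a_j}}{z-\overline{a_j}}\,B_j(z),\quad j\ge1,\qquad B_1(z)=1,\quad B_j(z)=\prod_{k=1}^{j-1}\chi_k\frac{z-a_k}{z-\overline{a_k}}\ (j\ge2),$$ with $\chi_k=\frac{|1+a_k^2|}{1+a_k^2}$. It is orthonormal with respect to the inner product $\frac1\pi\int_{-\infty}^\infty f(x)\overline{g(x)}\,dx$. $$R_{n,s}^\lambda(z)=\frac{A+Bz}{(z^2+\lambda^2)^{s+1}\,\tau_n(z,\bar{\bf a})},\qquad S_n(R_{n,s}^\lambda)(z)=\sum_{j=1}^n\left(\frac1\pi\int_{-\infty}^\infty R_{n,s}^\lambda(t)\overline{\Phi_j(t)}\,dt\right)\Phi_j(z).$$ The function $\tau_n(z,\bar{\bf a})\,S_n(R_{n,s}^\lambda)(z)$ is an algebraic polynomial in $z$ belonging to $P_{n-1}$.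
   Formalization: In G_k the numerator s(s+j)-2j is corrected to s(s+j)-2sj (as printed the formula fails, e.g. A=0, B=λ=n=ρ_0=1, s=2, a_1=i: 63π/1024 instead of 21π/1024), and χ_k is taken to be 1 when a_k=i, where it is 0/0. *)

theory Defs
  imports "HOL-Analysis.Analysis" "HOL-Computational_Algebra.Polynomial"
begin

text \<open>
  Sequences of points are functions \<open>nat \<Rightarrow> complex\<close> of which only the values at indices
  \<open>k \<ge> 1\<close> are used. For a sequence \<open>a\<close>, the conjugate sequence is \<open>\<lambda>k. cnj (a k)\<close>.
\<close>

definition tau :: "nat \<Rightarrow> complex \<Rightarrow> (nat \<Rightarrow> complex) \<Rightarrow> complex" where
  "tau n z c = (\<Prod>k=1..n. z - c k)"

text \<open>The extensional function space makes each vector \<open>(k\<^sub>1, \<dots>, k\<^sub>n)\<close> occur exactly once; the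
  index set of the sum is finite.\<close>

definition nu :: "nat \<Rightarrow> nat \<Rightarrow> complex \<Rightarrow> (nat \<Rightarrow> complex) \<Rightarrow> complex" where
  "nu n m z c =
     (\<Sum>k \<in> {k \<in> {1..n} \<rightarrow>\<^sub>E (UNIV :: nat set). (\<Sum>j=1..n. k j) = m}.
        \<Prod>j=1..n. 1 / (z - c j) ^ k j)"

text \<open>At \<open>w = \<i>\<close> the quotient is 0/0 (and would evaluate to 0). The usual convention there is 1;
  any unimodular value would do, since the factor only normalizes the phase.\<close>

definition chi :: "complex \<Rightarrow> complex" where
  "chi w = (if 1 + w\<^sup>2 = 0 then 1 else of_real (cmod (1 + w\<^sup>2)) / (1 + w\<^sup>2))"

definition blaschke :: "(nat \<Rightarrow> complex) \<Rightarrow> nat \<Rightarrow> complex \<Rightarrow> complex" where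
  "blaschke a j z = (\<Prod>k=1..<j. chi (a k) * ((z - a k) / (z - cnj (a k))))"

definition Phi :: "(nat \<Rightarrow> complex) \<Rightarrow> nat \<Rightarrow> complex \<Rightarrow> complex" where
  "Phi a j z = of_real (sqrt (Im (a j))) / (z - cnj (a j)) * blaschke a j z"

definition approximand :: "real \<Rightarrow> real \<Rightarrow> real \<Rightarrow> nat \<Rightarrow> complex \<Rightarrow> complex" where
  "approximand A B lam s z =
     (of_real A + of_real B * z) / (z\<^sup>2 + (of_real lam)\<^sup>2) ^ (s + 1)"

definition R :: "real \<Rightarrow> real \<Rightarrow> real \<Rightarrow> nat \<Rightarrow> (nat \<Rightarrow> complex) \<Rightarrow> nat \<Rightarrow> complex \<Rightarrow> complex" where
  "R A B lam s a n z =
     (of_real A + of_real B * z) /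
       ((z\<^sup>2 + (of_real lam)\<^sup>2) ^ (s + 1) * tau n z (\<lambda>k. cnj (a k)))"

definition fourier_sum :: "(nat \<Rightarrow> complex) \<Rightarrow> nat \<Rightarrow> (complex \<Rightarrow> complex) \<Rightarrow> complex \<Rightarrow> complex" where
  "fourier_sum a n f z =
     (\<Sum>j=1..n. (1 / of_real pi *
        (\<integral>t. f (complex_of_real t) * cnj (Phi a j (complex_of_real t)) \<partial>lborel)) * Phi a j z)"

definition rho :: "complex \<Rightarrow> (nat \<Rightarrow> complex) \<Rightarrow> nat \<Rightarrow> complex \<Rightarrow> complex" where
  "rho rho0 a n z = rho0 * (\<Prod>k=1..n. z - a k)"

definition polys :: "nat \<Rightarrow> complex poly set" where
  "polys m = {p. degree p \<le> m}"

definition weighted_dist ::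
    "real \<Rightarrow> real \<Rightarrow> real \<Rightarrow> nat \<Rightarrow> complex \<Rightarrow> (nat \<Rightarrow> complex) \<Rightarrow> nat \<Rightarrow> complex poly \<Rightarrow> real" where
  "weighted_dist A B lam s rho0 a n p =
     sqrt (\<integral>t. (cmod (approximand A B lam s (complex_of_real t) - poly p (complex_of_real t)))\<^sup>2
                / (cmod (rho rho0 a n (complex_of_real t)))\<^sup>2 \<partial>lborel)"

definition best_approx ::
    "real \<Rightarrow> real \<Rightarrow> real \<Rightarrow> nat \<Rightarrow> complex \<Rightarrow> (nat \<Rightarrow> complex) \<Rightarrow> nat \<Rightarrow> real" where
  "best_approx A B lam s rho0 a n =
     (INF p \<in> polys (n - 1). weighted_dist A B lam s rho0 a n p)"

text \<open>
  The last factor comes from the Taylor coefficients of \<open>(A + B z) / (z + \<i>\<lambda>)\<^bsup>s+1\<^esup>\<close> at \<open>\<i>\<lambda>\<close>: the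
  coefficient of \<open>(z - \<i>\<lambda>)\<^sup>j\<close> is
  \<open>(-1)\<^sup>j \<cdot> (s+j choose s) / (2\<i>\<lambda>)\<^bsup>s+1+j\<^esup> \<cdot> (A + \<i>B\<lambda> \<cdot> (1 - 2j / (s+j)))\<close>, because
  \<open>(s+j-1 choose s) = (s+j choose s) \<cdot> j / (s+j)\<close>. Hence the numerator below is
  \<open>s (s+j) - 2 s j\<close>. The source prints \<open>s (s+j) - 2 j\<close>, which agrees for \<open>s = 1\<close> or \<open>B = 0\<close>
  but makes the closed form for the best approximation false in general when \<open>s \<ge> 2\<close>.
\<close>

definition G :: "real \<Rightarrow> real \<Rightarrow> real \<Rightarrow> nat \<Rightarrow> (nat \<Rightarrow> complex) \<Rightarrow> nat \<Rightarrow> nat \<Rightarrow> complex" where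
  "G A B lam s a n k =
     (\<Sum>j=0..s-k.
        of_nat ((s + j) choose s) * \<i> ^ (s - k - j)
          * nu n (s - k - j) (\<i> * of_real lam) (\<lambda>i. cnj (a i))
          / (2 * of_real lam) ^ (k + j)
        * (of_real (B * lam * (real s * (real s + real j) - 2 * real s * real j)
                      / (real s * (real s + real j)))
           - \<i> * of_real A))"

end

theory Submission
  imports Defs "HOL-Complex_Analysis.Cauchy_Integral_Theorem" "HOL-Probability.Sinc_Integral"
    "HOL-Computational_Algebra.Polynomial_FPS"
begin

text \<open>
  On the real line \<open>|\<rho>\<^sub>n| = |\<rho>\<^sub>0| |\<tau>\<^sub>n|\<close>, so the problem is to project \<open>R = f / \<tau>\<^sub>n\<close>, with \<open>f\<close> the
  approximand, onto the span of the \<open>\<Phi>\<^sub>j\<close>, that is onto the quotients \<open>p / \<tau>\<^sub>n\<close>. Write \<open>r\<close> for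
  the principal part of \<open>R\<close> at \<open>\<i>\<lambda>\<close>, \<open>r\<^sup>*(z) = cnj (r (cnj z))\<close> for its reflection and
  \<open>\<sigma>\<^sub>n = \<Prod>(z - a\<^sub>k)\<close>. Since \<open>f\<close> is real on the real line, \<open>p = f - \<tau>\<^sub>n r - \<sigma>\<^sub>n r\<^sup>*\<close> has no poles,
  so it is a polynomial, and its error \<open>r + (\<sigma>\<^sub>n / \<tau>\<^sub>n) r\<^sup>*\<close> is orthogonal to every \<open>q / \<tau>\<^sub>n\<close>: the two
  integrands that arise have all their poles on one side of the real axis. For the same reason the
  two summands of the error are orthogonal to each other; they have equal norm, so the squared error
  is \<open>2 \<parallel>r\<parallel>\<^sup>2 / |\<rho>\<^sub>0|\<^sup>2\<close>. Expanding \<open>r\<close> in powers of \<open>1 / (z - \<i>\<lambda>)\<close> gives the double sum.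
\<close>

section \<open>Integrals of rational functions over the real line\<close>

text \<open>The quotient has a limit at infinity: the ratio of the leading coefficients for equal
  degrees, and 0 otherwise.\<close>

lemma poly_quotient_bounded_at_infinity:
  fixes P Q :: "complex poly"
  assumes "degree P \<le> degree Q" "Q \<noteq> 0"
  obtains C where "\<forall>\<^sub>F z in at_infinity. norm (poly P z / poly Q z) \<le> C"
proof -
  have "\<exists>L. ((\<lambda>z. poly P z / poly Q z) \<longlongrightarrow> L) at_infinity"
  proof (cases "degree P = degree Q")
    case True
    have "((\<lambda>z. (poly P z / z ^ degree P) / (poly Q z / z ^ degree Q))
        \<longlongrightarrow> lead_coeff P / lead_coeff Q) at_infinity"
      using assms by (intro tendsto_divide poly_divide_tendsto_aux) auto
    moreover have "\<forall>\<^sub>F z in at_infinity. (poly P z / z ^ degree P) / (poly Q z / z ^ degree Q)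
        = poly P z / poly Q z"
      by (rule eventually_at_infinityI[of 1]) (auto simp: True)
    ultimately show ?thesis by (blast intro: Lim_transform_eventually)
  next
    case False
    then show ?thesis using assms poly_divide_tendsto_0_at_infinity[of P Q] by auto
  qed
  then obtain L where "((\<lambda>z. poly P z / poly Q z) \<longlongrightarrow> L) at_infinity" by blast
  from tendsto_norm[OF this] have "\<forall>\<^sub>F z in at_infinity. norm (poly P z / poly Q z) < norm L + 1"
    by (rule order_tendstoD) simp
  then have "\<forall>\<^sub>F z in at_infinity. norm (poly P z / poly Q z) \<le> norm L + 1"
    by (rule eventually_mono) simp
  then show thesis by (rule that)
qed

lemma integrable_inverse_one_plus_square: "integrable lborel (\<lambda>t::real. inverse (1 + t\<^sup>2))"
  using integrable_inverse_1_plus_square by (simp add: set_integrable_def)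

lemma integral_inverse_one_plus_square: "(\<integral>t. inverse (1 + (t::real)\<^sup>2) \<partial>lborel) = pi"
  using LBINT_inverse_1_plus_square
  by (simp add: interval_lebesgue_integral_def set_lebesgue_integral_def)

text \<open>Comparison with \<open>1 / (1 + t^2)\<close>: the product of the quotient with
  \<open>1 + t^2\<close> is bounded, by continuity on a compact interval and by the degree gap
  outside it.\<close>

lemma integrable_poly_quotient:
  fixes P Q :: "complex poly"
  assumes deg: "degree P + 2 \<le> degree Q" and nz: "\<And>t::real. poly Q (of_real t) \<noteq> 0"
  shows "integrable lborel (\<lambda>t::real. poly P (of_real t) / poly Q (of_real t))"
proof -
  let ?g = "\<lambda>t::real. poly P (of_real t) / poly Q (of_real t)"
  \<comment> \<open>\<open>?S\<close> is \<open>z^2 P\<close>, whose degree is still at most that of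
    \<open>Q\<close>.\<close>
  let ?S = "pCons 0 (pCons 0 P)"
  have cont: "continuous_on A ?g" for A
    using nz by (intro continuous_intros) auto
  have "degree ?S \<le> degree Q" using deg by (simp add: degree_pCons_eq_if)
  moreover have "Q \<noteq> 0" using nz[of 0] by auto
  ultimately obtain C where "\<forall>\<^sub>F z in at_infinity. norm (poly ?S z / poly Q z) \<le> C"
    by (rule poly_quotient_bounded_at_infinity)
  then obtain r where r: "\<And>z. norm z \<ge> r \<Longrightarrow> norm (poly ?S z / poly Q z) \<le> C"
    by (auto simp: eventually_at_infinity)
  \<comment> \<open>Beyond radius 1 one has \<open>1 + t^2 \<le> 2 t^2\<close>, which turns the
    bound \<open>C\<close> for \<open>t^2 ?g\<close> into \<open>2 * C\<close>.\<close>
  define r' where "r' = max r 1"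
  have "compact ((\<lambda>t. ?g t * of_real (1 + t\<^sup>2)) ` {-r'..r'})"
    by (intro compact_continuous_image continuous_on_mult cont compact_Icc continuous_intros)
  then obtain K where K: "\<And>t. t \<in> {-r'..r'} \<Longrightarrow> norm (?g t * of_real (1 + t\<^sup>2)) \<le> K"
    by (force dest!: compact_imp_bounded simp: bounded_iff)
  have bd: "norm (?g t * of_real (1 + t\<^sup>2)) \<le> max K (2 * C)" for t
  proof (cases "t \<in> {-r'..r'}")
    case True
    then show ?thesis using K by (simp add: max.coboundedI1)
  next
    case False
    then have t: "\<bar>t\<bar> \<ge> r" "\<bar>t\<bar> \<ge> 1" by (auto simp: r'_def)
    have t2: "t\<^sup>2 \<ge> 1" using t(2) abs_le_square_iff[of 1 t] by simp
    have "norm (?g t) * t\<^sup>2 = norm (poly ?S (of_real t) / poly Q (of_real t))"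
      by (simp add: norm_mult norm_divide power2_eq_square)
    also have "\<dots> \<le> C" by (rule r) (use t in simp)
    finally have "norm (?g t) * t\<^sup>2 \<le> C" .
    moreover have "norm (?g t) * 1 \<le> norm (?g t) * t\<^sup>2"
      using t2 by (intro mult_left_mono) auto
    ultimately have "norm (?g t) * (1 + t\<^sup>2) \<le> 2 * C" by (simp add: algebra_simps)
    moreover have "norm (complex_of_real (1 + t\<^sup>2)) = 1 + t\<^sup>2"
      unfolding norm_of_real by simp
    ultimately show ?thesis by (simp only: norm_mult max.coboundedI2)
  qed
  show ?thesis
  proof (rule Bochner_Integration.integrable_bound)
    show "integrable lborel (\<lambda>t::real. max K (2 * C) * inverse (1 + t\<^sup>2))"
      using integrable_inverse_one_plus_square by (rule integrable_mult_right)
    show "?g \<in> borel_measurable lborel"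
      using cont[of UNIV] by (simp add: borel_measurable_continuous_onI)
    have "norm (?g t) \<le> norm (max K (2 * C) * inverse (1 + t\<^sup>2))" for t
    proof -
      have p: "1 + t\<^sup>2 > 0" by (simp add: add_pos_nonneg)
      have n: "norm (complex_of_real (1 + t\<^sup>2)) = 1 + t\<^sup>2" unfolding norm_of_real by simp
      have "norm (?g t) * (1 + t\<^sup>2) \<le> max K (2 * C)"
        using bd[of t] by (simp only: norm_mult n)
      then have "norm (?g t) \<le> max K (2 * C) * inverse (1 + t\<^sup>2)"
        using p by (simp add: field_simps)
      then show ?thesis by (simp only: real_norm_def)
    qed
    then show "AE t in lborel. norm (?g t) \<le> norm (max K (2 * C) * inverse (1 + t\<^sup>2))" by simp
  qed
qed

text \<open>Applied to the roots of a denominator, this leaves a strip above the real axis free of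
  poles, so that a primitive exists on an open set containing the axis.\<close>

lemma finite_set_half_plane_margin:
  assumes "finite A" "\<And>z. z \<in> A \<Longrightarrow> Im z > 0"
  obtains e where "e > 0" "\<And>z. z \<in> A \<Longrightarrow> Im z > e"
proof (cases "A = {}")
  case True
  then show thesis using that[of 1] by auto
next
  case False
  show thesis
  proof (rule that[of "Min (Im ` A) / 2"])
    show "Min (Im ` A) / 2 > 0" using assms False by auto
    fix z assume "z \<in> A"
    then have "Min (Im ` A) \<le> Im z" "Im z > 0" using assms by auto
    moreover have "Min (Im ` A) > 0" using assms False by auto
    ultimately show "Im z > Min (Im ` A) / 2" by linarith
  qed
qed

text \<open>Cauchy's theorem for the lower half plane: a primitive exists there, and the decay of order
  \<open>1/|z|\<^sup>2\<close> makes its increment along large half circles vanish.\<close>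

lemma integral_poly_quotient_upper:
  fixes P Q :: "complex poly"
  assumes deg: "degree P + 2 \<le> degree Q" and roots: "\<And>z. poly Q z = 0 \<Longrightarrow> Im z > 0"
  shows "(\<integral>t. poly P (of_real t) / poly Q (of_real t) \<partial>lborel) = 0"
proof -
  let ?g = "\<lambda>z. poly P z / poly Q z"
  have nz: "poly Q (of_real t) \<noteq> 0" for t :: real using roots[of "of_real t"] by auto
  have Q0: "Q \<noteq> 0" using nz[of 0] by auto
  have int: "integrable lborel (\<lambda>t::real. ?g (of_real t))"
    by (rule integrable_poly_quotient[OF deg nz])
  obtain e where e: "e > 0" "\<And>z. poly Q z = 0 \<Longrightarrow> Im z > e"
    using finite_set_half_plane_margin[of "{z. poly Q z = 0}"] poly_roots_finite[OF Q0] roots by auto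
  \<comment> \<open>\<open>S\<close> is open, convex and free of poles, and it contains the real
    axis together with the lower half circles used below.\<close>
  define S where "S = {z. Im z < e}"
  have "?g holomorphic_on S"
    by (intro holomorphic_intros) (auto simp: S_def dest: e(2))
  moreover have "convex S" "open S"
    by (auto simp: S_def convex_halfspace_Im_lt open_halfspace_Im_lt)
  ultimately obtain F where F: "\<And>z. z \<in> S \<Longrightarrow> (F has_field_derivative ?g z) (at z within S)"
    using holomorphic_convex_primitive' by metis
  have FTC: "(\<integral>t. indicator {-T..T} t *\<^sub>R ?g (of_real t) \<partial>lborel) = F (of_real T) - F (of_real (- T))"
    if "T \<ge> 0" for T :: real
  proof (rule integral_FTC_atLeastAtMost[of "-T" T "\<lambda>t. F (of_real t)"])
    show "continuous_on {- T..T} (\<lambda>t. ?g (complex_of_real t))"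
      using nz by (intro continuous_intros) auto
    fix x :: real
    have xS: "of_real x \<in> S" using e(1) by (simp add: S_def)
    then have "(F has_field_derivative ?g (of_real x)) (at (of_real x))"
      using F[OF xS] at_within_open[OF xS \<open>open S\<close>] by (simp only:)
    then have "((\<lambda>t. F (of_real t)) has_vector_derivative ?g (of_real x)) (at x)"
      by (rule has_vector_derivative_real_field)
    then show "((\<lambda>t. F (of_real t)) has_vector_derivative ?g (of_real x)) (at x within {-T..T})"
      by (rule has_vector_derivative_at_within)
  qed (use that in simp)
  have arc: "\<forall>\<^sub>F T in at_top. norm (F (of_real T) - F (of_real (- T))) \<le> \<epsilon> * pi" if "\<epsilon> > 0" for \<epsilon> :: real
  proof -
    \<comment> \<open>\<open>pCons 0 P\<close> is \<open>z P\<close>, so the degree gap of two gives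
      \<open>z * ?g z\<close> tending to 0.\<close>
    have "degree (pCons 0 P) < degree Q" using deg by (simp add: degree_pCons_eq_if)
    then have "((\<lambda>z. poly (pCons 0 P) z / poly Q z) \<longlongrightarrow> 0) at_infinity"
      by (rule poly_divide_tendsto_0_at_infinity)
    then have "\<forall>\<^sub>F z in at_infinity. norm (poly (pCons 0 P) z / poly Q z) < \<epsilon>"
      using that unfolding tendsto_iff dist_norm by simp
    then obtain r where r: "\<And>z. norm z \<ge> r \<Longrightarrow> norm (z * ?g z) < \<epsilon>"
      by (auto simp: eventually_at_infinity)
    show ?thesis
    proof (rule eventually_at_top_linorderI[of "max r 1"])
      fix T :: real assume T: "T \<ge> max r 1"
      \<comment> \<open>The lower half circle from \<open>-T\<close> to \<open>T\<close>: there
        \<open>?g\<close> is at most \<open>\<epsilon> / T\<close> in modulus, and the length is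
        \<open>pi * T\<close>.\<close>
      let ?c = "part_circlepath 0 T (- pi) 0"
      have img: "norm z = T \<and> Im z \<le> 0" if z: "z \<in> path_image ?c" for z
      proof -
        have "z \<in> {z. \<exists>x. z = 0 + of_real T * exp (\<i> * of_real x) \<and> - pi \<le> x \<and> x \<le> 0}"
          using z by (auto simp: path_image_part_circlepath)
        then obtain x where x: "z = of_real T * exp (\<i> * of_real x)" "- pi \<le> x" "x \<le> 0" by auto
        have "sin (- x) \<ge> 0" using x by (intro sin_ge_zero) auto
        then show ?thesis using T x
          by (auto simp: norm_mult Im_exp mult_nonneg_nonpos)
      qed
      have sub: "path_image ?c \<subseteq> S" using img e(1) by (force simp: S_def)
      have "(?g has_contour_integral (F (pathfinish ?c) - F (pathstart ?c))) ?c"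
        using F sub by (intro contour_integral_primitive) auto
      then have "norm (F (pathfinish ?c) - F (pathstart ?c)) \<le> (\<epsilon> / T) * T * (0 - (- pi))"
      proof (rule has_contour_integral_bound_part_circlepath)
        fix z assume "z \<in> path_image ?c"
        then have z: "norm z = T" using img by blast
        then have "T * norm (?g z) < \<epsilon>" using r[of z] T by (simp add: norm_mult norm_divide)
        then show "norm (?g z) \<le> \<epsilon> / T" using T by (simp add: field_simps)
      qed (use T that in auto)
      moreover have "pathfinish ?c = of_real T" "pathstart ?c = of_real (- T)"
        by (auto simp: exp_minus)
      ultimately show "norm (F (of_real T) - F (of_real (- T))) \<le> \<epsilon> * pi" using T by simp
    qed
  qed
  have "(\<lambda>m. \<integral>t. indicator {-real m..real m} t *\<^sub>R ?g (of_real t) \<partial>lborel)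
      \<longlonglongrightarrow> (\<integral>t. ?g (of_real t) \<partial>lborel)"
  proof (rule integral_dominated_convergence[where w = "\<lambda>t. norm (?g (of_real t))"])
    show "AE t in lborel. (\<lambda>m. indicator {- real m..real m} t *\<^sub>R ?g (of_real t)) \<longlonglongrightarrow> ?g (of_real t)"
    proof (rule AE_I2)
      fix t :: real
      have "\<forall>\<^sub>F m in sequentially. indicator {- real m..real m} t *\<^sub>R ?g (of_real t) = ?g (of_real t)"
      proof (rule eventually_sequentiallyI[of "nat \<lceil>\<bar>t\<bar>\<rceil>"])
        fix m assume "nat \<lceil>\<bar>t\<bar>\<rceil> \<le> m"
        then have "\<bar>t\<bar> \<le> real m" by linarith
        then show "indicator {- real m..real m} t *\<^sub>R ?g (of_real t) = ?g (of_real t)"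
          by (auto simp: indicator_def)
      qed
      then show "(\<lambda>m. indicator {- real m..real m} t *\<^sub>R ?g (of_real t)) \<longlonglongrightarrow> ?g (of_real t)"
        by (rule tendsto_eventually)
    qed
    show "(\<lambda>t::real. ?g (of_real t)) \<in> borel_measurable lborel" using int by simp
    then show "(\<lambda>t. indicator {- real m..real m} t *\<^sub>R ?g (of_real t)) \<in> borel_measurable lborel" for m
      by measurable
    show "integrable lborel (\<lambda>t::real. norm (?g (of_real t)))" using int by simp
    show "AE t in lborel. norm (indicator {- real m..real m} t *\<^sub>R ?g (of_real t)) \<le> norm (?g (of_real t))" for m
      by (rule AE_I2) (auto simp: indicator_def)
  qed
  moreover have "(\<lambda>m. \<integral>t. indicator {-real m..real m} t *\<^sub>R ?g (of_real t) \<partial>lborel) \<longlonglongrightarrow> 0"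
  proof (rule tendstoI)
    fix \<epsilon> :: real assume "\<epsilon> > 0"
    \<comment> \<open>With \<open>\<epsilon> / (2 * pi)\<close> the arc bound is half of
      \<open>\<epsilon>\<close>, which gives the strict inequality.\<close>
    then have "\<forall>\<^sub>F T in at_top. norm (F (of_real T) - F (of_real (- T))) \<le> \<epsilon> / (2 * pi) * pi"
      by (intro arc) simp
    then have "\<forall>\<^sub>F m in sequentially. norm (F (of_real (real m)) - F (of_real (- real m))) \<le> \<epsilon> / (2 * pi) * pi"
      using filterlim_real_sequentially by (rule eventually_compose_filterlim)
    then show "\<forall>\<^sub>F m in sequentially. dist (\<integral>t. indicator {-real m..real m} t *\<^sub>R ?g (of_real t) \<partial>lborel) 0 < \<epsilon>"
      using \<open>\<epsilon> > 0\<close> by (elim eventually_mono) (subst FTC, auto simp: dist_norm)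
  qed
  ultimately show ?thesis by (rule LIMSEQ_unique)
qed

text \<open>Conjugating the coefficients reflects the roots in the real axis and conjugates the
  integral, which reduces this to the previous case.\<close>

lemma integral_poly_quotient_lower:
  fixes P Q :: "complex poly"
  assumes deg: "degree P + 2 \<le> degree Q" and roots: "\<And>z. poly Q z = 0 \<Longrightarrow> Im z < 0"
  shows "(\<integral>t. poly P (of_real t) / poly Q (of_real t) \<partial>lborel) = 0"
proof -
  have "(\<integral>t. poly (map_poly cnj P) (of_real t) / poly (map_poly cnj Q) (of_real t) \<partial>lborel) = 0"
  proof (rule integral_poly_quotient_upper)
    show "degree (map_poly cnj P) + 2 \<le> degree (map_poly cnj Q)"
      using deg by (simp add: degree_map_poly)
    fix z assume "poly (map_poly cnj Q) z = 0"
    then show "Im z > 0" using roots[of "cnj z"] by simp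
  qed
  then have "cnj (\<integral>t. poly P (of_real t) / poly Q (of_real t) \<partial>lborel) = 0"
    by (simp flip: complex_cnj_divide)
  then show ?thesis by simp
qed

text \<open>The substitution \<open>t = Re w + Im w * x\<close> turns the integrand into a multiple
  of \<open>1 / (1 + x^2)\<close>.\<close>

lemma integral_one_over_norm_square:
  assumes "Im w > 0"
  shows "(\<integral>t. 1 / ((of_real t - w) * (of_real t - cnj w)) \<partial>lborel) = of_real (pi / Im w)"
proof -
  have eq: "1 / ((of_real (Re w + Im w * x) - w) * (of_real (Re w + Im w * x) - cnj w))
      = complex_of_real (inverse (1 + x\<^sup>2) / (Im w)\<^sup>2)" for x :: real
  proof -
    have "(of_real (Re w + Im w * x) - w) * (of_real (Re w + Im w * x) - cnj w)
        = complex_of_real ((1 + x\<^sup>2) * (Im w)\<^sup>2)"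
      by (simp add: complex_eq_iff power2_eq_square algebra_simps)
    then show ?thesis by (simp add: field_simps)
  qed
  have "(\<integral>t. 1 / ((of_real t - w) * (of_real t - cnj w)) \<partial>lborel)
      = \<bar>Im w\<bar> *\<^sub>R (\<integral>x. complex_of_real (inverse (1 + x\<^sup>2) / (Im w)\<^sup>2) \<partial>lborel)"
    using assms by (subst lborel_integral_real_affine[of "Im w" _ "Re w"]) (simp_all only: eq less_irrefl)
  also have "\<dots> = of_real (Im w * (pi / (Im w)\<^sup>2))"
    using assms by (simp only: integral_complex_of_real integral_divide_zero integral_inverse_one_plus_square)
      (simp add: scaleR_conv_of_real)
  finally show ?thesis using assms by (simp add: power2_eq_square)
qed

text \<open>Up to a factor \<open>2\<i> Im w\<close>, the partial fractions of \<open>1 / ((t - w) (t - cnj w))\<close> give these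
  integrals the recursion of Pascal's triangle.\<close>

lemma has_bochner_integral_conjugate_poles:
  assumes w: "Im w > 0"
  shows "has_bochner_integral lborel
           (\<lambda>t. 1 / ((of_real t - w) ^ Suc k * (of_real t - cnj w) ^ Suc l))
           (2 * pi * of_nat ((k + l) choose k) * \<i> ^ k * (- \<i>) ^ l / (2 * complex_of_real (Im w)) ^ Suc (k + l))"
proof -
  let ?I = "\<lambda>k l. \<integral>t. 1 / ((of_real t - w) ^ k * (of_real t - cnj w) ^ l) \<partial>lborel"
  let ?J = "\<lambda>k l. 2 * pi * of_nat ((k + l) choose k) * \<i> ^ k * (- \<i>) ^ l / (2 * complex_of_real (Im w)) ^ Suc (k + l)"
  define y where "y = complex_of_real (Im w)"
  have y0: "y \<noteq> 0" using w by (simp add: y_def)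
  define Q where "Q k l = [:- w, 1:] ^ k * [:- cnj w, 1:] ^ l" for k l
  have degQ: "degree (Q k l) = k + l" for k l
    unfolding Q_def by (subst degree_mult_eq) (simp_all add: degree_power_eq)
  have Q: "?I k l = (\<integral>t. poly 1 (of_real t) / poly (Q k l) (of_real t) \<partial>lborel)" for k l
    by (simp add: Q_def algebra_simps)
  have nz: "of_real t - w \<noteq> 0" "of_real t - cnj w \<noteq> 0" for t :: real
    using w by (auto simp: complex_eq_iff)
  have int: "integrable lborel (\<lambda>t::real. 1 / ((of_real t - w) ^ k * (of_real t - cnj w) ^ l))"
    if "k + l \<ge> 2" for k l
  proof -
    have "integrable lborel (\<lambda>t::real. poly 1 (of_real t) / poly (Q k l) (of_real t))"
      using nz that by (intro integrable_poly_quotient) (auto simp: degQ, auto simp: Q_def)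
    then show ?thesis by (simp add: Q_def algebra_simps)
  qed
  have upper: "?I k 0 = 0" if "k \<ge> 2" for k
    unfolding Q using w that
    by (intro integral_poly_quotient_upper) (auto simp: degQ, auto simp: Q_def)
  have lower: "?I 0 l = 0" if "l \<ge> 2" for l
    unfolding Q using w that
    by (intro integral_poly_quotient_lower) (auto simp: degQ, auto simp: Q_def)
  \<comment> \<open>The condition on \<open>k + l\<close> gives both denominators on the right
    degree at least 2, so the integral of the difference may be split.\<close>
  have rec: "?I (Suc k) (Suc l) = (?I (Suc k) l - ?I k (Suc l)) / (2 * \<i> * y)" if "k + l \<ge> 1" for k l
  proof -
    have "1 / ((of_real t - w) ^ Suc k * (of_real t - cnj w) ^ Suc l)
        = (1 / ((of_real t - w) ^ Suc k * (of_real t - cnj w) ^ l)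
          - 1 / ((of_real t - w) ^ k * (of_real t - cnj w) ^ Suc l)) / (2 * \<i> * y)" for t :: real
    proof -
      have "(of_real t - cnj w) - (of_real t - w) = 2 * \<i> * y"
        by (simp add: y_def complex_eq_iff)
      moreover have "1 / (u ^ Suc k * v ^ Suc l)
          = (1 / (u ^ Suc k * v ^ l) - 1 / (u ^ k * v ^ Suc l)) / d"
        if "u \<noteq> 0" "v \<noteq> 0" "d \<noteq> 0" "v - u = d" for u v d :: complex
      proof -
        have "1 / (u ^ Suc k * v ^ l) - 1 / (u ^ k * v ^ Suc l) = (v - u) / (u ^ Suc k * v ^ Suc l)"
          using that(1,2) by (simp add: field_simps)
        then show ?thesis using that by simp
      qed
      ultimately show ?thesis using nz[of t] y0 by simp
    qed
    then show ?thesis using that by (simp only: integral_divide_zero)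
        (subst Bochner_Integration.integral_diff, auto intro!: int simp del: power_Suc)
  qed
  have J: "?J k l = 2 * pi * of_nat ((k + l) choose k) * \<i> ^ k * (- \<i>) ^ l / (2 * y) ^ Suc (k + l)" for k l
    by (simp add: y_def)
  have base: "?I (Suc 0) (Suc 0) = ?J 0 0"
    using integral_one_over_norm_square[OF w] by simp
  \<comment> \<open>With \<open>w\<close> of order one, the subtracted integral in the recursion has
    \<open>cnj w\<close> as its only pole and vanishes by \<open>lower\<close>.\<close>
  have lrow: "?I (Suc 0) (Suc l) = ?J 0 l" for l
  proof (induction l)
    case 0
    show ?case by (rule base)
  next
    case (Suc l)
    show ?case using y0 by (subst rec, simp, subst lower, simp, subst Suc, subst (1 2) J)
        (simp add: field_simps)
  qed
  \<comment> \<open>Outer induction on \<open>k\<close>, inner on \<open>l\<close>. In the column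
    \<open>l = 0\<close> the integral with the single pole \<open>w\<close> vanishes by
    \<open>upper\<close>; elsewhere the recursion is Pascal's rule, the signs coming from dividing
    by \<open>2 * \<i> * y\<close>.\<close>
  have "?I (Suc k) (Suc l) = ?J k l"
  proof (induction k arbitrary: l)
    case 0
    show ?case by (rule lrow)
  next
    case (Suc k l)
    show ?case
    proof (induction l)
      case 0
      show ?case using y0 by (subst rec, simp, subst upper, simp, subst Suc, subst (1 2) J)
          (simp add: field_simps)
    next
      case (Suc l')
      show ?case using y0
        by (subst rec, simp, subst Suc, subst \<open>\<And>l. ?I (Suc k) (Suc l) = ?J k l\<close>, subst (1 2 3) J)
          (simp add: field_simps)
    qed
  qed
  moreover have "integrable lborel (\<lambda>t. 1 / ((of_real t - w) ^ Suc k * (of_real t - cnj w) ^ Suc l))"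
    by (rule int) simp
  ultimately show ?thesis by (simp only: has_bochner_integral_iff)
qed

section \<open>Taylor coefficients at \<open>\<i>\<lambda>\<close>\<close>

lemma finite_compositions:
  assumes "finite A"
  shows "finite {k \<in> A \<rightarrow>\<^sub>E (UNIV :: nat set). (\<Sum>j\<in>A. k j) = m}"
proof (rule finite_subset)
  show "{k \<in> A \<rightarrow>\<^sub>E UNIV. (\<Sum>j\<in>A. k j) = m} \<subseteq> A \<rightarrow>\<^sub>E {..m}"
  proof
    fix k :: "'a \<Rightarrow> nat"
    assume k: "k \<in> {k \<in> A \<rightarrow>\<^sub>E UNIV. (\<Sum>j\<in>A. k j) = m}"
    have "k j \<le> m" if "j \<in> A" for j
      using member_le_sum[of j A k] that k assms by auto
    then show "k \<in> A \<rightarrow>\<^sub>E {..m}" using k by (auto simp: PiE_iff)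
  qed
  show "finite (A \<rightarrow>\<^sub>E {..m})" using assms by (simp add: finite_PiE)
qed

text \<open>Vectors are grouped by their last coordinate \<open>i\<close>. The result is a Cauchy
  product with a geometric series, the form needed for power series.\<close>

lemma nu_Suc: "nu (Suc n) m z c = (\<Sum>i\<le>m. (1 / (z - c (Suc n))) ^ i * nu n (m - i) z c)"
proof -
  let ?T = "\<lambda>i. {k \<in> {1..n} \<rightarrow>\<^sub>E (UNIV :: nat set). (\<Sum>j=1..n. k j) = m - i}"
  have upd: "(\<Sum>j=1..n. (k(Suc n := i)) j) = (\<Sum>j=1..n. k j)"
    "(\<Prod>j=1..n. 1 / (z - c j) ^ (k(Suc n := i)) j) = (\<Prod>j=1..n. 1 / (z - c j) ^ k j)"
    for k :: "nat \<Rightarrow> nat" and i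
    by (auto intro!: sum.cong prod.cong)
  have "(\<Sum>i\<le>m. (1 / (z - c (Suc n))) ^ i * nu n (m - i) z c)
      = (\<Sum>(i, k)\<in>Sigma {..m} ?T. (1 / (z - c (Suc n))) ^ i * (\<Prod>j=1..n. 1 / (z - c j) ^ k j))"
    unfolding nu_def sum_distrib_left using finite_compositions[of "{1..n}"]
    by (subst sum.Sigma) auto
  also have "\<dots> = nu (Suc n) m z c"
    unfolding nu_def
  \<comment> \<open>A pair \<open>(i, k)\<close> corresponds to the vector \<open>k\<close> extended
    by the coordinate \<open>i\<close>. Resetting that coordinate to \<open>undefined\<close> leads
    back to the extensional functions on \<open>{1..n}\<close>.\<close>
  proof (rule sum.reindex_bij_witness
      [where j = "\<lambda>(i, k). k(Suc n := i)" and i = "\<lambda>k. (k (Suc n), k(Suc n := undefined))"])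
    fix p assume p: "p \<in> Sigma {..m} ?T"
    obtain i k where ik: "p = (i, k)" by (cases p)
    have k: "k \<in> {1..n} \<rightarrow>\<^sub>E UNIV" "(\<Sum>j=1..n. k j) = m - i" "i \<le> m" using p by (auto simp: ik)
    have "k (Suc n) = undefined" using k(1) by (auto simp: PiE_iff extensional_def)
    then show "(\<lambda>k. (k (Suc n), k(Suc n := undefined))) ((\<lambda>(i, k). k(Suc n := i)) p) = p"
      by (auto simp: ik)
    show "(\<lambda>(i, k). k(Suc n := i)) p \<in> {k \<in> {1..Suc n} \<rightarrow>\<^sub>E UNIV. (\<Sum>j = 1..Suc n. k j) = m}"
      using k upd[of k i] by (auto simp: ik PiE_iff extensional_def)
    show "(\<Prod>j=1..Suc n. 1 / (z - c j) ^ (\<lambda>(i, k). k(Suc n := i)) p j)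
        = (case p of (i, k) \<Rightarrow> (1 / (z - c (Suc n))) ^ i * (\<Prod>j=1..n. 1 / (z - c j) ^ k j))"
      using upd[of k i] by (simp add: ik power_one_over mult.commute)
  next
    fix k assume k: "k \<in> {k \<in> {1..Suc n} \<rightarrow>\<^sub>E (UNIV :: nat set). (\<Sum>j = 1..Suc n. k j) = m}"
    then show "(\<lambda>(i, k). k(Suc n := i)) (k (Suc n), k(Suc n := undefined)) = k" by auto
    show "(k (Suc n), k(Suc n := undefined)) \<in> Sigma {..m} ?T"
      using k upd[of k undefined] by (auto simp: PiE_iff extensional_def)
  qed
  finally show ?thesis ..
qed

text \<open>The signs come from \<open>1 / (z - c + w) = (\<Sum>m. (-w)\<^sup>m / (z - c)\<^bsup>m+1\<^esup>)\<close>, so that the \<open>\<nu>\<^sub>m\<close> are the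
  normalised Taylor coefficients of \<open>1 / \<tau>\<^sub>n\<close> at \<open>z\<close>.\<close>

lemma fps_nu:
  assumes "\<And>j. j \<in> {1..n} \<Longrightarrow> z \<noteq> c j"
  shows "fps_of_poly (\<Prod>j=1..n. [:z - c j, 1:]) * Abs_fps (\<lambda>m. (-1) ^ m * nu n m z c)
       = fps_const (tau n z c)"
  using assms
proof (induction n)
  case 0
  have "nu 0 m z c = (if m = 0 then 1 else 0)" for m
    by (cases m) (auto simp: nu_def)
  then show ?case by (auto simp: fps_eq_iff tau_def)
next
  case (Suc n)
  define d where "d = z - c (Suc n)"
  have d: "d \<noteq> 0" using Suc.prems[of "Suc n"] by (simp add: d_def)
  let ?N = "\<lambda>n. Abs_fps (\<lambda>m. (-1) ^ m * nu n m z c)"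
  \<comment> \<open>The geometric series of \<open>d / (d + X)\<close>, the contribution of the new
    factor.\<close>
  let ?A = "Abs_fps (\<lambda>m. (- 1 / d) ^ m)"
  have "(-1) ^ m * nu (Suc n) m z c = (\<Sum>i=0..m. (- 1 / d) ^ i * ((-1) ^ (m - i) * nu n (m - i) z c))" for m
    unfolding nu_Suc sum_distrib_left d_def[symmetric] atMost_atLeast0
  proof (rule sum.cong)
    fix i assume "i \<in> {0..m}"
    then have "(-1 :: complex) ^ m = (-1) ^ i * (-1) ^ (m - i)" by (simp flip: power_add)
    moreover have "(- 1 / d) ^ i = (-1) ^ i * (1 / d) ^ i" by (simp flip: power_mult_distrib)
    ultimately show "(- 1) ^ m * ((1 / d) ^ i * nu n (m - i) z c)
        = (- 1 / d) ^ i * ((- 1) ^ (m - i) * nu n (m - i) z c)" by simp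
  qed simp
  then have N: "?N (Suc n) = ?A * ?N n"
    by (simp add: fps_eq_iff fps_mult_nth)
  have "fps_of_poly [:d, 1:] * ?A = fps_const d"
  proof (rule fps_ext)
    fix m show "fps_nth (fps_of_poly [:d, 1:] * ?A) m = fps_nth (fps_const d) m"
      using d by (cases m) (simp_all add: fps_of_poly_pCons fps_of_poly_const ring_distribs)
  qed
  moreover have "fps_of_poly (\<Prod>j=1..n. [:z - c j, 1:]) * ?N n = fps_const (tau n z c)"
    using Suc by simp
  moreover have "fps_of_poly (\<Prod>j=1..Suc n. [:z - c j, 1:]) * ?N (Suc n)
      = (fps_of_poly (\<Prod>j=1..n. [:z - c j, 1:]) * ?N n) * (fps_of_poly [:d, 1:] * ?A)"
    by (simp add: N fps_of_poly_mult d_def mult_ac)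
  ultimately show ?case by (simp add: tau_def d_def)
qed

text \<open>The negative binomial series of \<open>1 / (\<mu> + X)^(s+1)\<close>. Multiplying the
  series for \<open>s + 1\<close> by \<open>\<mu> + X\<close> gives the one for \<open>s\<close>, by
  Pascal's rule.\<close>

lemma fps_inverse_linear_power:
  fixes \<mu> :: complex
  assumes "\<mu> \<noteq> 0"
  shows "fps_of_poly ([:\<mu>, 1:] ^ Suc s)
       * Abs_fps (\<lambda>j. (-1) ^ j * of_nat ((s + j) choose s) / \<mu> ^ (s + 1 + j)) = 1"
proof (induction s)
  case 0
  show ?case
  proof (rule fps_ext)
    fix m show "fps_nth (fps_of_poly ([:\<mu>, 1:] ^ Suc 0)
       * Abs_fps (\<lambda>j. (-1) ^ j * of_nat ((0 + j) choose 0) / \<mu> ^ (0 + 1 + j))) m = fps_nth 1 m"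
      using assms
      by (cases m) (simp_all add: fps_of_poly_pCons fps_of_poly_const ring_distribs field_simps)
  qed
next
  case (Suc s)
  let ?U = "\<lambda>s. Abs_fps (\<lambda>j. (-1) ^ j * of_nat ((s + j) choose s) / \<mu> ^ (s + 1 + j))"
  have "fps_of_poly [:\<mu>, 1:] * ?U (Suc s) = ?U s"
  proof (rule fps_ext)
    fix m show "fps_nth (fps_of_poly [:\<mu>, 1:] * ?U (Suc s)) m = fps_nth (?U s) m"
      using assms
      by (cases m) (simp_all add: fps_of_poly_pCons fps_of_poly_const ring_distribs field_simps)
  qed
  then have "fps_of_poly ([:\<mu>, 1:] ^ Suc s) * (fps_of_poly [:\<mu>, 1:] * ?U (Suc s)) = 1"
    using Suc by simp
  moreover have "fps_of_poly ([:\<mu>, 1:] ^ Suc (Suc s))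
      = fps_of_poly ([:\<mu>, 1:] ^ Suc s) * fps_of_poly [:\<mu>, 1:]"
    by (simp only: power_Suc2 fps_of_poly_mult)
  ultimately show ?case by (simp only: mult.assoc)
qed

text \<open>Cutting \<open>H\<close> off after order \<open>s\<close> leaves the coefficients of
  \<open>V * H\<close> up to order \<open>s\<close> unchanged. This turns an identity of power
  series into a divisibility of polynomials.\<close>

lemma fps_truncation_dvd:
  fixes V W :: "'a :: idom poly" and H :: "'a fps"
  assumes "fps_of_poly V * H = fps_of_poly W"
  shows "monom 1 (Suc s) dvd W - V * (\<Sum>m\<le>s. monom (fps_nth H m) m)"
  unfolding monom_1_dvd_iff'
proof (intro allI impI)
  fix m assume "m < Suc s"
  have T: "coeff (\<Sum>m\<le>s. monom (fps_nth H m) m) i = fps_nth H i" if "i \<le> s" for i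
    using that by (simp add: coeff_sum)
  have "coeff W m = fps_nth (fps_of_poly V * H) m" by (simp add: assms)
  also have "\<dots> = coeff (V * (\<Sum>m\<le>s. monom (fps_nth H m) m)) m"
    using \<open>m < Suc s\<close> T by (simp add: fps_mult_nth coeff_mult atMost_atLeast0)
  finally show "coeff (W - V * (\<Sum>m\<le>s. monom (fps_nth H m) m)) m = 0" by simp
qed


text \<open>With \<open>X = z - \<i>\<lambda>\<close> this is the Taylor expansion of
  \<open>(A + B z) / (z + \<i>\<lambda>)^(s+1)\<close> at \<open>\<i>\<lambda>\<close>: the negative
  binomial series times a linear polynomial, with the two neighbouring binomial coefficients merged
  into one.\<close>

lemma fps_approximand_quotient:
  fixes A B lam :: real
  assumes lam: "lam > 0" and s: "s \<ge> 1"
  shows "fps_of_poly ([:2 * \<i> * of_real lam, 1:] ^ Suc s)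
       * Abs_fps (\<lambda>j. (-1) ^ j * of_nat ((s + j) choose s) / (2 * \<i> * of_real lam) ^ (s + 1 + j)
            * (\<i> * (of_real (B * lam * (real s * (real s + real j) - 2 * real s * real j)
                      / (real s * (real s + real j))) - \<i> * of_real A)))
       = fps_of_poly [:of_real A + \<i> * of_real B * of_real lam, of_real B:]"
proof -
  define \<mu> where "\<mu> = 2 * \<i> * complex_of_real lam"
  have \<mu>: "\<mu> \<noteq> 0" using lam by (simp add: \<mu>_def)
  define a0 where "a0 = of_real A + \<i> * of_real B * complex_of_real lam"
  define g where "g j = \<i> * (of_real (B * lam * (real s * (real s + real j) - 2 * real s * real j)
                      / (real s * (real s + real j))) - \<i> * complex_of_real A)" for j
  define U where "U = Abs_fps (\<lambda>j. (-1) ^ j * of_nat ((s + j) choose s) / \<mu> ^ (s + 1 + j))"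
  \<comment> \<open>Since \<open>s \<ge> 1\<close>, a factor \<open>s\<close> cancels and the
    fraction becomes \<open>1 - 2 j / (s + j)\<close>.\<close>
  have g: "g j = a0 - of_real B * \<mu> * (of_nat j / of_nat (s + j))" for j
  proof -
    have "B * lam * (real s * (real s + real j) - 2 * real s * real j) / (real s * (real s + real j))
        = B * lam * (1 - 2 * (real j / real (s + j)))"
      using s by (simp add: divide_simps) (simp add: algebra_simps)
    then show ?thesis unfolding g_def a0_def \<mu>_def
      by (simp only:) (simp add: algebra_simps)
  qed
  have E: "Abs_fps (\<lambda>j. (-1) ^ j * of_nat ((s + j) choose s) / \<mu> ^ (s + 1 + j) * g j)
      = U * fps_of_poly [:a0, of_real B:]"
  proof (rule fps_ext)
    fix m
    show "fps_nth (Abs_fps (\<lambda>j. (-1) ^ j * of_nat ((s + j) choose s) / \<mu> ^ (s + 1 + j) * g j)) m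
        = fps_nth (U * fps_of_poly [:a0, of_real B:]) m"
    proof (cases m)
      case 0
      then show ?thesis by (simp add: g U_def)
    next
      case (Suc j)
      \<comment> \<open>Absorption identity, expressing the binomial coefficient of index
        \<open>j\<close> through that of index \<open>j + 1\<close>.\<close>
      have "Suc (s + j) * ((s + j) choose s) = Suc j * (Suc (s + j) choose s)"
        using Suc_times_binomial_eq[of "s + j" j]
          binomial_symmetric[of s "s + j"] binomial_symmetric[of s "Suc (s + j)"]
        by (simp add: mult.commute Suc_diff_le)
      then have "complex_of_nat (Suc (s + j)) * of_nat ((s + j) choose s)
          = of_nat (Suc j) * of_nat (Suc (s + j) choose s)"
        by (simp only: flip: of_nat_mult)
      then have C: "complex_of_nat ((s + j) choose s)
          = of_nat (Suc (s + j) choose s) * (of_nat (Suc j) / of_nat (Suc (s + j)))"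
        by (simp add: field_simps del: of_nat_Suc)
      have "fps_nth (U * fps_of_poly [:a0, of_real B:]) m
          = fps_nth U (Suc j) * a0 + fps_nth U j * of_real B"
        by (simp add: Suc fps_of_poly_pCons fps_of_poly_const ring_distribs mult.assoc[symmetric])
      also have "\<dots> = (-1) ^ Suc j / \<mu> ^ (s + 1 + Suc j) *
          (of_nat (Suc (s + j) choose s) * a0 - of_nat ((s + j) choose s) * \<mu> * of_real B)"
        using \<mu> by (simp add: U_def field_simps)
      also have "\<dots> = (-1) ^ Suc j * of_nat ((s + Suc j) choose s) / \<mu> ^ (s + 1 + Suc j) * g (Suc j)"
      proof -
        have "x / y * (K * a0 - K * q * \<mu> * of_real B) = x * K / y * (a0 - of_real B * \<mu> * q)"
          for x y K q :: complex by (simp add: algebra_simps)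
        then show ?thesis unfolding g C add_Suc_right .
      qed
      finally show ?thesis by (simp add: Suc)
    qed
  qed
  have "fps_of_poly ([:\<mu>, 1:] ^ Suc s) * (U * fps_of_poly [:a0, of_real B:])
      = fps_of_poly [:a0, of_real B:]"
    using fps_inverse_linear_power[OF \<mu>, of s] unfolding U_def by (simp only: mult.assoc[symmetric] mult_1)
  then show ?thesis
    unfolding E[symmetric] unfolding \<mu>_def a0_def g_def .
qed

lemma pcompose_power: "pcompose (p ^ n) q = pcompose p q ^ n"
  by (induction n) (simp_all add: pcompose_mult pcompose_1)

text \<open>\<open>G\<^sub>k\<close> is, up to normalisation, the coefficient \<open>c\<^sub>k\<close> of \<open>1 / (z - \<i>\<lambda>)\<^bsup>k+1\<^esup>\<close> in the principal part at
  \<open>\<i>\<lambda>\<close> of the rational function \<open>(A + B z) / ((z\<^sup>2 + \<lambda>\<^sup>2)\<^bsup>s+1\<^esup> \<tau>\<^sub>n)\<close>.\<close>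

lemma G_principal_part:
  fixes A B lam :: real
  assumes lam: "lam > 0" and s: "s \<ge> 1"
    and ne: "\<And>j. j \<in> {1..n} \<Longrightarrow> \<i> * of_real lam \<noteq> cnj (a j)"
  obtains c :: "nat \<Rightarrow> complex" where
    "\<And>k. k \<le> s \<Longrightarrow> G A B lam s a n k = (2 * of_real lam) ^ Suc s
        * tau n (\<i> * of_real lam) (\<lambda>j. cnj (a j)) * (c k * \<i> ^ k / (2 * of_real lam) ^ k)"
    "[:- (\<i> * of_real lam), 1:] ^ Suc s dvd [:of_real A, of_real B:]
        - [:\<i> * of_real lam, 1:] ^ Suc s * (\<Prod>j=1..n. [:- cnj (a j), 1:])
          * (\<Sum>k\<le>s. smult (c k) ([:- (\<i> * of_real lam), 1:] ^ (s - k)))"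
proof -
  define L where "L = complex_of_real lam"
  have L: "L \<noteq> 0" using lam by (simp add: L_def)
  define z0 where "z0 = \<i> * L"
  define \<tau> where "\<tau> = tau n z0 (\<lambda>j. cnj (a j))"
  \<comment> \<open>\<open>V\<close> is \<open>tau\<close> in the shifted variable
    \<open>X = z - z0\<close>.\<close>
  define V where "V = (\<Prod>j=1..n. [:z0 - cnj (a j), 1:])"
  have \<tau>0: "\<tau> \<noteq> 0" using ne by (auto simp: \<tau>_def tau_def z0_def L_def)
  define \<nu> where "\<nu> m = nu n m z0 (\<lambda>j. cnj (a j))" for m
  define N where "N = Abs_fps (\<lambda>m. (-1) ^ m * \<nu> m)"
  define b where "b j = of_real (B * lam * (real s * (real s + real j) - 2 * real s * real j)
                      / (real s * (real s + real j))) - \<i> * complex_of_real A" for j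
  define E where "E = Abs_fps (\<lambda>j. (-1) ^ j * of_nat ((s + j) choose s) / (2 * \<i> * L) ^ (s + 1 + j)
            * (\<i> * b j))"
  \<comment> \<open>The Taylor series at \<open>z0\<close> of
    \<open>(A + B z) / ((z + z0)^(s+1) * tau)\<close>; the factor \<open>1 / \<tau>\<close> undoes
    the normalisation of \<open>N\<close>.\<close>
  define H where "H = fps_const (1 / \<tau>) * (E * N)"
  \<comment> \<open>Division by \<open>(z - z0)^(s+1)\<close> moves the Taylor coefficient of order
    \<open>s - k\<close> to the pole term \<open>1 / (z - z0)^(k+1)\<close>.\<close>
  define c where "c k = fps_nth H (s - k)" for k
  let ?W = "[:of_real A + \<i> * of_real B * L, of_real B:]"
  have VN: "fps_of_poly V * N = fps_const \<tau>"
    using ne fps_nu[of n z0 "\<lambda>j. cnj (a j)"]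
    by (auto simp: V_def N_def \<nu>_def \<tau>_def z0_def L_def)
  have UE: "fps_of_poly ([:2 * \<i> * L, 1:] ^ Suc s) * E = fps_of_poly ?W"
    using fps_approximand_quotient[OF lam s, of B A] unfolding E_def b_def L_def .
  have "fps_of_poly ([:2 * \<i> * L, 1:] ^ Suc s * V) * H
      = fps_const (1 / \<tau>) * (fps_of_poly ([:2 * \<i> * L, 1:] ^ Suc s) * E) * (fps_of_poly V * N)"
    by (simp add: fps_of_poly_mult H_def mult_ac)
  also have "\<dots> = fps_of_poly ?W * (fps_const (1 / \<tau>) * fps_const \<tau>)"
    unfolding VN UE by (simp only: mult_ac)
  also have "fps_const (1 / \<tau>) * fps_const \<tau> = 1" using \<tau>0 by simp
  finally have "fps_of_poly ([:2 * \<i> * L, 1:] ^ Suc s * V) * H = fps_of_poly ?W" by simp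
  \<comment> \<open>Composition with \<open>X - z0\<close> moves the expansion point from 0 back to
    \<open>z0\<close>.\<close>
  from fps_truncation_dvd[OF this, of s]
  have "pcompose (monom 1 (Suc s)) [:- z0, 1:] dvd pcompose (?W - [:2 * \<i> * L, 1:] ^ Suc s * V
      * (\<Sum>m\<le>s. monom (fps_nth H m) m)) [:- z0, 1:]"
    by (auto elim!: dvdE simp: pcompose_mult)
  moreover have "pcompose (monom 1 (Suc s)) [:- z0, 1:] = [:- z0, 1:] ^ Suc s"
    by (simp only: monom_altdef smult_1_left pcompose_power pcompose_idR) (simp add: pcompose_pCons)
  moreover have "pcompose (\<Sum>m\<le>s. monom (fps_nth H m) m) [:- z0, 1:]
      = (\<Sum>k\<le>s. smult (c k) ([:- z0, 1:] ^ (s - k)))"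
  proof -
    have "pcompose (\<Sum>m\<le>s. monom (fps_nth H m) m) [:- z0, 1:]
        = (\<Sum>m\<le>s. smult (fps_nth H m) ([:- z0, 1:] ^ m))"
      by (simp add: pcompose_sum monom_altdef pcompose_smult pcompose_power pcompose_pCons)
    also have "\<dots> = (\<Sum>k\<le>s. smult (c k) ([:- z0, 1:] ^ (s - k)))"
      by (rule sum.reindex_bij_witness[where i = "\<lambda>k. s - k" and j = "\<lambda>k. s - k"]) (auto simp: c_def)
    finally show ?thesis .
  qed
  moreover have "pcompose V [:- z0, 1:] = (\<Prod>j=1..n. [:- cnj (a j), 1:])"
    unfolding V_def pcompose_prod by (intro prod.cong) (auto simp: pcompose_pCons)
  moreover have "pcompose ?W [:- z0, 1:] = [:of_real A, of_real B:]"
    by (simp add: pcompose_pCons z0_def)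
  moreover have "pcompose [:2 * \<i> * L, 1:] [:- z0, 1:] = [:z0, 1:]"
    by (simp add: pcompose_pCons z0_def)
  ultimately have dvd: "[:- z0, 1:] ^ Suc s dvd [:of_real A, of_real B:]
      - [:z0, 1:] ^ Suc s * (\<Prod>j=1..n. [:- cnj (a j), 1:])
        * (\<Sum>k\<le>s. smult (c k) ([:- z0, 1:] ^ (s - k)))"
    by (simp only: pcompose_diff pcompose_mult pcompose_power)
  have "G A B lam s a n k = (2 * L) ^ Suc s * \<tau> * (c k * \<i> ^ k / (2 * L) ^ k)" if k: "k \<le> s" for k
  proof -
    have summand: "(2 * L) ^ Suc s * (\<i> ^ k / (2 * L) ^ k
          * (((-1) ^ j * of_nat ((s + j) choose s) / (2 * \<i> * L) ^ (s + 1 + j) * (\<i> * b j))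
          * ((-1) ^ (s - k - j) * \<nu> (s - k - j))))
        = of_nat ((s + j) choose s) * \<i> ^ (s - k - j) * \<nu> (s - k - j) / (2 * L) ^ (k + j) * b j"
      if j: "j \<le> s - k" for j
    proof -
      \<comment> \<open>Collecting the powers of \<open>\<i>\<close>: one \<open>\<i>\<close> of the
        denominator cancels against the one before \<open>b j\<close>, and the signs are absorbed as
        powers of \<open>\<i>^2\<close>.\<close>
      have "(s - k - j) + (s + j) = 2 * (s - k) + k" using j k by simp
      then have "\<i> ^ (s - k - j) * \<i> ^ (s + j) = (\<i>\<^sup>2) ^ (s - k) * \<i> ^ k"
        by (simp only: flip: power_mult power_add)
      also have "(\<i>\<^sup>2) ^ (s - k) = (-1) ^ (j + (s - k - j))"
        by (simp only: le_add_diff_inverse[OF j] power2_i)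
      also have "\<dots> = (-1) ^ j * (-1) ^ (s - k - j)" by (rule power_add)
      finally have i: "\<i> ^ k * (-1) ^ j * (-1) ^ (s - k - j) / \<i> ^ (s + j) = \<i> ^ (s - k - j)"
        by (simp add: field_simps)
      have "(2 * L) ^ Suc s * (\<i> ^ k / (2 * L) ^ k
          * (((-1) ^ j * of_nat ((s + j) choose s) / (2 * \<i> * L) ^ (s + 1 + j) * (\<i> * b j))
          * ((-1) ^ (s - k - j) * \<nu> (s - k - j))))
        = of_nat ((s + j) choose s) * (\<i> ^ k * (-1) ^ j * (-1) ^ (s - k - j) / \<i> ^ (s + j))
          * \<nu> (s - k - j) / (2 * L) ^ (k + j) * b j"
        using L by (simp add: field_simps power_add)
      then show ?thesis unfolding i .
    qed
    have "c k = 1 / \<tau> * (\<Sum>j=0..s - k. fps_nth E j * fps_nth N (s - k - j))"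
      by (simp only: c_def H_def fps_mult_left_const_nth fps_mult_nth[of E N])
    then have "(2 * L) ^ Suc s * \<tau> * (c k * \<i> ^ k / (2 * L) ^ k)
        = (2 * L) ^ Suc s * (\<i> ^ k / (2 * L) ^ k
          * (\<Sum>j=0..s - k. fps_nth E j * fps_nth N (s - k - j)))"
      using \<tau>0 by simp
    also have "\<dots> = (\<Sum>j=0..s - k. (2 * L) ^ Suc s * (\<i> ^ k / (2 * L) ^ k
          * (fps_nth E j * fps_nth N (s - k - j))))"
      by (simp only: sum_distrib_left)
    also have "\<dots> = G A B lam s a n k"
      unfolding G_def
    proof (intro sum.cong refl)
      fix j assume "j \<in> {0..s - k}"
      then have "j \<le> s - k" by simp
      from summand[OF this]
      have "(2 * L) ^ Suc s * (\<i> ^ k / (2 * L) ^ k * (fps_nth E j * fps_nth N (s - k - j)))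
          = of_nat ((s + j) choose s) * \<i> ^ (s - k - j) * \<nu> (s - k - j) / (2 * L) ^ (k + j) * b j"
        by (simp only: E_def N_def fps_nth_Abs_fps)
      then show "(2 * L) ^ Suc s * (\<i> ^ k / (2 * L) ^ k * (fps_nth E j * fps_nth N (s - k - j)))
          = of_nat ((s + j) choose s) * \<i> ^ (s - k - j)
          * nu n (s - k - j) (\<i> * of_real lam) (\<lambda>i. cnj (a i)) / (2 * of_real lam) ^ (k + j)
          * (of_real (B * lam * (real s * (real s + real j) - 2 * real s * real j)
                      / (real s * (real s + real j))) - \<i> * of_real A)"
        by (simp only: b_def \<nu>_def z0_def L_def)
    qed
    finally show ?thesis ..
  qed
  with dvd show thesis by (intro that[of c]) (auto simp: L_def z0_def \<tau>_def)
qed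

section \<open>The Takenaka--Malmquist system\<close>

definition root_poly :: "nat \<Rightarrow> (nat \<Rightarrow> complex) \<Rightarrow> complex poly" where
  "root_poly n c = (\<Prod>j=1..n. [:- c j, 1:])"

lemma poly_root_poly [simp]: "poly (root_poly n c) z = tau n z c"
  by (simp add: root_poly_def tau_def poly_prod)

lemma root_poly_neq_0: "root_poly n c \<noteq> 0"
  by (auto simp: root_poly_def)

lemma degree_root_poly [simp]: "degree (root_poly n c) = n"
  unfolding root_poly_def by (subst degree_prod_eq_sum_degree) auto

lemma tau_eq_0_iff: "tau n z c = 0 \<longleftrightarrow> z \<in> c ` {1..n}"
  by (auto simp: tau_def)

lemma tau_Suc: "tau (Suc n) z c = tau n z c * (z - c (Suc n))"
  by (simp add: tau_def)

lemma cnj_tau: "cnj (tau n z c) = tau n (cnj z) (\<lambda>k. cnj (c k))"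
  by (simp add: tau_def)

lemma tau_real_neq_0:
  assumes "\<And>k. k \<in> {1..n} \<Longrightarrow> Im (a k) > 0"
  shows "tau n (of_real t) a \<noteq> 0" "tau n (of_real t) (\<lambda>k. cnj (a k)) \<noteq> 0"
proof -
  have "of_real t \<noteq> a k" "of_real t \<noteq> cnj (a k)" if "k \<in> {1..n}" for k
    using assms[OF that] by (auto simp: complex_eq_iff)
  then show "tau n (of_real t) a \<noteq> 0" "tau n (of_real t) (\<lambda>k. cnj (a k)) \<noteq> 0"
    unfolding tau_eq_0_iff by blast+
qed

text \<open>This makes the weight \<open>1 / |tau|^2\<close> on the real line a rational function,
  so that the integrals above apply.\<close>

lemma cmod_tau_real:
  "complex_of_real ((cmod (tau n (of_real t) a))\<^sup>2)
    = tau n (of_real t) a * tau n (of_real t) (\<lambda>k. cnj (a k))"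
  by (simp only: complex_norm_square cnj_tau complex_cnj_complex_of_real)

lemma has_bochner_integral_upper:
  fixes P Q :: "complex poly"
  assumes "degree P + 2 \<le> degree Q" and roots: "\<And>z. poly Q z = 0 \<Longrightarrow> Im z > 0"
  shows "has_bochner_integral lborel (\<lambda>t. poly P (of_real t) / poly Q (of_real t)) 0"
proof -
  have "poly Q (of_real t) \<noteq> 0" for t :: real using roots[of "of_real t"] by auto
  then show ?thesis
    using integrable_poly_quotient integral_poly_quotient_upper assms
    by (auto simp: has_bochner_integral_iff)
qed

text \<open>The shape taken by all vanishing integrals of the error: every pole, \<open>w\<close> or
  some \<open>a k\<close>, lies in the upper half plane.\<close>

lemma integral_pole_times_root_poly:
  assumes "Im w > 0" "\<And>k. k \<in> {1..n} \<Longrightarrow> Im (a k) > 0" "degree P + 2 \<le> Suc m + n"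
  shows "has_bochner_integral lborel
    (\<lambda>t. poly P (of_real t) / ((of_real t - w) ^ Suc m * tau n (of_real t) a)) 0"
proof -
  let ?Q = "[:- w, 1:] ^ Suc m * root_poly n a"
  have deg: "degree ?Q = Suc m + n"
    by (subst degree_mult_eq) (simp_all add: root_poly_neq_0 degree_power_eq del: power_Suc)
  have "has_bochner_integral lborel (\<lambda>t. poly P (of_real t) / poly ?Q (of_real t)) 0"
  proof (rule has_bochner_integral_upper)
    fix z assume "poly ?Q z = 0"
    then have "z = w \<or> tau n z a = 0" by (simp del: power_Suc)
    then show "Im z > 0" using assms unfolding tau_eq_0_iff by auto
  qed (use assms deg in simp)
  then show ?thesis by (simp del: power_Suc add: algebra_simps)
qed

lemma cmod_chi: "cmod (chi w) = 1"
  by (simp add: chi_def norm_divide)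

definition Phi_const :: "(nat \<Rightarrow> complex) \<Rightarrow> nat \<Rightarrow> complex" where
  "Phi_const a j = of_real (sqrt (Im (a j))) * (\<Prod>k=1..<j. chi (a k))"

lemma cmod_Phi_const: "Im (a j) > 0 \<Longrightarrow> (cmod (Phi_const a j))\<^sup>2 = Im (a j)"
  by (simp add: Phi_const_def norm_mult prod_norm[symmetric] cmod_chi)

text \<open>The Blaschke product supplies the conjugate factors up to \<open>n\<close>, and the
  leading factor of \<open>Phi\<close> completes the denominator to index
  \<open>n + 1\<close>.\<close>

lemma Phi_Suc:
  "Phi a (Suc n) z = Phi_const a (Suc n) * tau n z a / tau (Suc n) z (\<lambda>k. cnj (a k))"
  by (simp add: Phi_def blaschke_def Phi_const_def tau_Suc prod.distrib prod_dividef
      atLeastLessThanSuc_atLeastAtMost tau_def mult_ac)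

text \<open>Puts the first \<open>n\<close> functions over one denominator: each step of the
  induction multiplies the old numerators by the new linear factor.\<close>

lemma Phi_numerator:
  assumes "j \<in> {1..n}"
  obtains D where "degree D < n"
    "\<And>z. tau n z (\<lambda>k. cnj (a k)) \<noteq> 0 \<Longrightarrow> Phi a j z = poly D z / tau n z (\<lambda>k. cnj (a k))"
proof -
  have "\<exists>D. degree D < n \<and> (\<forall>z. tau n z (\<lambda>k. cnj (a k)) \<noteq> 0 \<longrightarrow>
      Phi a j z = poly D z / tau n z (\<lambda>k. cnj (a k)))"
    using assms
  proof (induction n)
    case (Suc n)
    show ?case
    proof (cases "j = Suc n")
      case True
      have "degree (smult (Phi_const a (Suc n)) (root_poly n a)) < Suc n"
        by (rule le_less_trans[OF degree_smult_le]) simp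
      then show ?thesis
        unfolding True by (intro exI[of _ "smult (Phi_const a (Suc n)) (root_poly n a)"]) (simp add: Phi_Suc)
    next
      case False
      then obtain D where D: "degree D < n" "\<And>z. tau n z (\<lambda>k. cnj (a k)) \<noteq> 0 \<Longrightarrow>
          Phi a j z = poly D z / tau n z (\<lambda>k. cnj (a k))"
        using Suc by force
      have "degree (D * [:- cnj (a (Suc n)), 1:]) < Suc n"
        by (rule le_less_trans[OF degree_mult_le]) (use D(1) in simp)
      then show ?thesis
        by (intro exI[of _ "D * [:- cnj (a (Suc n)), 1:]"]) (auto simp: tau_Suc D(2) simp flip: left_diff_distrib)
    qed
  qed simp
  then show thesis using that by blast
qed

text \<open>The coefficient of the last function is chosen so that the remaining numerator vanishes
  at \<open>cnj (a n)\<close>; that factor cancels and the induction goes on.\<close>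

lemma Phi_span:
  assumes a: "\<And>k. k \<ge> 1 \<Longrightarrow> Im (a k) > 0" and q: "q = 0 \<or> degree q < n"
  obtains c where "\<And>z. tau n z (\<lambda>k. cnj (a k)) \<noteq> 0 \<Longrightarrow>
    poly q z / tau n z (\<lambda>k. cnj (a k)) = (\<Sum>j=1..n. c j * Phi a j z)"
proof -
  have "\<exists>c. \<forall>z. tau n z (\<lambda>k. cnj (a k)) \<noteq> 0 \<longrightarrow>
    poly q z / tau n z (\<lambda>k. cnj (a k)) = (\<Sum>j=1..n. c j * Phi a j z)"
    using q
  proof (induction n arbitrary: q)
    case 0
    then show ?case by simp
  next
    case (Suc n)
    define w where "w = cnj (a (Suc n))"
    define \<kappa> where "\<kappa> = Phi_const a (Suc n)"
    have "Im w < 0" using a[of "Suc n"] by (simp add: w_def)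
    then have tw: "tau n w a \<noteq> 0" using a unfolding tau_eq_0_iff by force
    have \<kappa>: "\<kappa> \<noteq> 0" using cmod_Phi_const[of a "Suc n"] a[of "Suc n"] by (auto simp: \<kappa>_def)
    \<comment> \<open>The division is legitimate because \<open>w\<close> lies in the lower half
      plane while the zeros of \<open>tau n _ a\<close> lie in the upper one.\<close>
    define c0 where "c0 = poly q w / (\<kappa> * tau n w a)"
    define q1 where "q1 = q - smult (c0 * \<kappa>) (root_poly n a)"
    have "poly q1 w = 0" using tw \<kappa> by (simp add: q1_def c0_def)
    then obtain q2 where q2: "q1 = [:- w, 1:] * q2" by (auto simp: poly_eq_0_iff_dvd elim: dvdE)
    have "degree q1 \<le> n"
      using Suc.prems unfolding q1_def
      by (intro degree_diff_le degree_smult_le[THEN order_trans]) auto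
    \<comment> \<open>For \<open>n = 0\<close> only the zero numerator remains, which
      \<open>degree q2 < n\<close> cannot express.\<close>
    then have "q2 = 0 \<or> degree q2 < n"
      unfolding q2 by (cases "q2 = 0") (simp_all add: degree_mult_eq del: mult_pCons_left)
    then obtain c where c: "\<And>z. tau n z (\<lambda>k. cnj (a k)) \<noteq> 0 \<Longrightarrow>
        poly q2 z / tau n z (\<lambda>k. cnj (a k)) = (\<Sum>j=1..n. c j * Phi a j z)"
      using Suc.IH by blast
    show ?case
    proof (intro exI[of _ "c(Suc n := c0)"] allI impI)
      fix z assume z: "tau (Suc n) z (\<lambda>k. cnj (a k)) \<noteq> 0"
      then have zw: "z - w \<noteq> 0" and zn: "tau n z (\<lambda>k. cnj (a k)) \<noteq> 0"
        by (auto simp: tau_Suc w_def)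
      have "q = q1 + smult (c0 * \<kappa>) (root_poly n a)"
        by (simp add: q1_def)
      then have "poly q z = poly q1 z + c0 * (\<kappa> * tau n z a)"
        by simp
      also have "poly q1 z = (z - w) * poly q2 z"
        by (simp add: q2 algebra_simps)
      finally have "poly q z = (z - w) * poly q2 z + c0 * (\<kappa> * tau n z a)" .
      then have "poly q z / tau (Suc n) z (\<lambda>k. cnj (a k))
          = poly q2 z / tau n z (\<lambda>k. cnj (a k)) + c0 * Phi a (Suc n) z"
        using zw zn by (simp add: Phi_Suc tau_Suc w_def[symmetric] \<kappa>_def[symmetric] add_divide_distrib)
      also have "\<dots> = (\<Sum>j=1..Suc n. (c(Suc n := c0)) j * Phi a j z)"
        unfolding c[OF zn] by (auto intro!: sum.cong)
      finally show "poly q z / tau (Suc n) z (\<lambda>k. cnj (a k)) = (\<Sum>j=1..Suc n. (c(Suc n := c0)) j * Phi a j z)" .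
    qed
  qed
  then show thesis using that by blast
qed

text \<open>The numerator of the conjugated later function cancels the denominator of the earlier
  one; all remaining poles are in the upper half plane.\<close>

lemma Phi_orthogonal_less:
  assumes a: "\<And>k. k \<ge> 1 \<Longrightarrow> Im (a k) > 0" and ij: "1 \<le> i" "i < j"
  shows "has_bochner_integral lborel (\<lambda>t. Phi a i (of_real t) * cnj (Phi a j (of_real t))) 0"
proof -
  obtain m where m: "j = Suc m" using ij by (cases j) auto
  have "i \<in> {1..m}" using ij m by auto
  then obtain D where D: "degree D < m" "\<And>z. tau m z (\<lambda>k. cnj (a k)) \<noteq> 0 \<Longrightarrow>
      Phi a i z = poly D z / tau m z (\<lambda>k. cnj (a k))"
    using Phi_numerator by blast
  have ne: "tau m (of_real t) a \<noteq> 0" "tau m (of_real t) (\<lambda>k. cnj (a k)) \<noteq> 0" for t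
    using a tau_real_neq_0[of m a] by auto
  have eq: "Phi a i (of_real t) * cnj (Phi a j (of_real t))
      = cnj (Phi_const a j) * (poly D (of_real t) / poly (root_poly j a) (of_real t))" for t :: real
    using ne[of t] by (simp add: D(2) m Phi_Suc cnj_tau)
  have "has_bochner_integral lborel
      (\<lambda>t. poly D (of_real t) / poly (root_poly j a) (of_real t)) 0"
  proof (rule has_bochner_integral_upper)
    show "degree D + 2 \<le> degree (root_poly j a)" using D(1) m by simp
    show "Im z > 0" if "poly (root_poly j a) z = 0" for z
      using that a by (auto simp: tau_eq_0_iff)
  qed
  then have "has_bochner_integral lborel (\<lambda>t. cnj (Phi_const a j)
      * (poly D (of_real t) / poly (root_poly j a) (of_real t))) (cnj (Phi_const a j) * 0)"
    by (intro has_bochner_integral_mult_right)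
  then show ?thesis by (simp only: eq mult_zero_right)
qed

text \<open>On the diagonal the Blaschke factors have modulus one and
  \<open>Im (a j) / |t - a j|^2\<close> remains. The value is \<open>pi\<close> because the factor
  \<open>1 / pi\<close> of the inner product is left out.\<close>

lemma Phi_orthonormal:
  assumes a: "\<And>k. k \<ge> 1 \<Longrightarrow> Im (a k) > 0" and ij: "1 \<le> i" "1 \<le> j"
  shows "has_bochner_integral lborel (\<lambda>t. Phi a i (of_real t) * cnj (Phi a j (of_real t)))
           (if i = j then of_real pi else 0)"
proof (cases i j rule: linorder_cases)
  case less
  then show ?thesis using Phi_orthogonal_less[OF a] ij by simp
next
  case greater
  then have "has_bochner_integral lborel (\<lambda>t. cnj (Phi a j (of_real t) * cnj (Phi a i (of_real t)))) (cnj 0)"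
    using Phi_orthogonal_less[OF a] ij by (intro has_bochner_integral_cnj) auto
  then show ?thesis using greater by (simp add: mult.commute)
next
  case equal
  obtain m where m: "j = Suc m" using ij by (cases j) auto
  have y: "Im (a j) > 0" using a ij by simp
  have ne: "tau m (of_real t) a \<noteq> 0" "tau m (of_real t) (\<lambda>k. cnj (a k)) \<noteq> 0" for t
    using a tau_real_neq_0[of m a] by auto
  have "Phi_const a j * cnj (Phi_const a j) = of_real (Im (a j))"
    using cmod_Phi_const[of a j, OF y] by (simp only: complex_norm_square[symmetric])
  moreover have "Phi a i (of_real t) * cnj (Phi a j (of_real t))
      = (Phi_const a j * cnj (Phi_const a j)) * (1 / ((of_real t - a j) * (of_real t - cnj (a j))))" for t
    using ne[of t] by (simp add: equal m Phi_Suc cnj_tau tau_Suc)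
  moreover have "has_bochner_integral lborel (\<lambda>t. of_real (Im (a j)) *
      (1 / ((of_real t - a j) * (of_real t - cnj (a j))))) (of_real (Im (a j)) * of_real (pi / Im (a j)))"
    using has_bochner_integral_conjugate_poles[OF y, of 0 0]
    by (intro has_bochner_integral_mult_right) simp
  ultimately show ?thesis using y equal by simp
qed

section \<open>Orthogonality of the error\<close>

lemma degree_map_poly_cnj [simp]: "degree (map_poly cnj p) = degree p"
  by (rule degree_map_poly) simp

text \<open>This is \<open>\<tau>\<^sub>n r\<close> on the real axis for \<open>r = N / (z - w)\<^bsup>s+1\<^esup>\<close>; its conjugate
  is \<open>\<sigma>\<^sub>n r\<^sup>*\<close>.\<close>

definition half_error :: "(nat \<Rightarrow> complex) \<Rightarrow> nat \<Rightarrow> nat \<Rightarrow> complex \<Rightarrow> complex poly \<Rightarrow> real \<Rightarrow> complex" where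
  "half_error a n s w N t =
    tau n (of_real t) (\<lambda>k. cnj (a k)) * poly N (of_real t) / (of_real t - w) ^ Suc s"

text \<open>Against \<open>h\<close> the conjugate half of the weight cancels and only poles in the
  upper half plane are left. The other summand is the conjugate of such an integral, taken with
  \<open>q\<close> in place of its conjugate.\<close>

lemma error_orthogonal:
  fixes a :: "nat \<Rightarrow> complex" and n s :: nat and w :: complex and N :: "complex poly"
  defines "h \<equiv> half_error a n s w N"
  assumes a: "\<And>k. k \<in> {1..n} \<Longrightarrow> Im (a k) > 0" and w: "Im w > 0" and N: "degree N \<le> s"
    and q: "degree q < n"
  shows "has_bochner_integral lborel (\<lambda>t. (h t + cnj (h t)) * cnj (poly q (of_real t))
           / (tau n (of_real t) a * tau n (of_real t) (\<lambda>k. cnj (a k)))) 0"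
proof -
  have one: "has_bochner_integral lborel (\<lambda>t. h t * poly r (of_real t)
      / (tau n (of_real t) a * tau n (of_real t) (\<lambda>k. cnj (a k)))) 0" if "degree r < n" for r
  proof -
    have "has_bochner_integral lborel (\<lambda>t. poly (N * r) (of_real t)
        / ((of_real t - w) ^ Suc s * tau n (of_real t) a)) 0"
      using degree_mult_le[of N r] N that by (intro integral_pole_times_root_poly w a) auto
    moreover have "poly (N * r) (of_real t) / ((of_real t - w) ^ Suc s * tau n (of_real t) a)
        = h t * poly r (of_real t)
          / (tau n (of_real t) a * tau n (of_real t) (\<lambda>k. cnj (a k)))" for t
      using tau_real_neq_0[of n a t] a by (simp add: h_def half_error_def del: power_Suc)
    ultimately show ?thesis by (simp only:)
  qed
  from has_bochner_integral_add[OF one[of "map_poly cnj q"] has_bochner_integral_cnj[OF one[OF q]]]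
  show ?thesis using q
    by (simp add: cnj_tau add_divide_distrib ring_distribs mult.commute[of "tau n _ a"])
qed

text \<open>In the expansion of \<open>|h + cnj h|^2\<close> the terms \<open>h^2\<close> and its
  conjugate integrate to 0, which leaves twice the integral of \<open>|h|^2\<close>.\<close>

lemma half_error_norm:
  fixes a :: "nat \<Rightarrow> complex" and n s :: nat and w :: complex and N :: "complex poly" and c :: "nat \<Rightarrow> complex"
  defines "h \<equiv> half_error a n s w N"
  assumes a: "\<And>k. k \<in> {1..n} \<Longrightarrow> Im (a k) > 0" and w: "Im w > 0" and N: "degree N \<le> s"
    and c: "N = (\<Sum>k\<le>s. smult (c k) ([:- w, 1:] ^ (s - k)))"
  shows "has_bochner_integral lborel
     (\<lambda>t. (h t + cnj (h t)) * cnj (h t + cnj (h t))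
        / (tau n (of_real t) a * tau n (of_real t) (\<lambda>k. cnj (a k))))
     (4 * pi * (\<Sum>k\<le>s. \<Sum>l\<le>s. of_nat ((k + l) choose k) * (c k * \<i> ^ k) * cnj (c l * \<i> ^ l)
        / (2 * complex_of_real (Im w)) ^ Suc (k + l)))"
proof -
  let ?W = "\<lambda>t. tau n (complex_of_real t) a * tau n (of_real t) (\<lambda>k. cnj (a k))"
  have nzw: "of_real t - w \<noteq> 0" for t using w by (auto simp: complex_eq_iff)
  \<comment> \<open>The degree gap is exactly two here: at most \<open>n + 2 s\<close> against
    \<open>n + 2 s + 2\<close>.\<close>
  have "has_bochner_integral lborel (\<lambda>t. poly (root_poly n (\<lambda>k. cnj (a k)) * (N * N)) (of_real t)
      / ((of_real t - w) ^ Suc (2 * s + 1) * tau n (of_real t) a)) 0"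
    using degree_mult_le[of N N] N degree_mult_le[of "root_poly n (\<lambda>k. cnj (a k))" "N * N"]
    by (intro integral_pole_times_root_poly w a) auto
  moreover have "poly (root_poly n (\<lambda>k. cnj (a k)) * (N * N)) (of_real t)
      / ((of_real t - w) ^ Suc (2 * s + 1) * tau n (of_real t) a) = h t * h t / ?W t" for t
  proof -
    have "Suc (2 * s + 1) = Suc s + Suc s" by simp
    then have "(of_real t - w) ^ Suc (2 * s + 1) = (of_real t - w) ^ Suc s * (of_real t - w) ^ Suc s"
      by (simp only: power_add)
    then show ?thesis
      using tau_real_neq_0[of n a t] a nzw[of t] by (simp add: h_def half_error_def mult_ac del: power_Suc)
  qed
  ultimately have sq: "has_bochner_integral lborel (\<lambda>t. h t * h t / ?W t) 0"
    by (simp only:)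
  have ratio: "poly N (of_real t) / (of_real t - w) ^ Suc s
      = (\<Sum>k\<le>s. c k / (of_real t - w) ^ Suc k)" for t :: real
  proof -
    have "c k * (of_real t - w) ^ (s - k) / (of_real t - w) ^ Suc s = c k / (of_real t - w) ^ Suc k"
      if "k \<le> s" for k
    proof -
      have "Suc s = (s - k) + Suc k" using that by simp
      then have "(of_real t - w) ^ Suc s = (of_real t - w) ^ (s - k) * (of_real t - w) ^ Suc k"
        by (simp only: power_add)
      then show ?thesis using nzw[of t] by simp
    qed
    then show ?thesis by (simp add: c poly_sum sum_divide_distrib)
  qed
  \<comment> \<open>The factors \<open>tau\<close> cancel against the weight, so only the squared
    modulus of the principal part is integrated.\<close>
  have "h t * cnj (h t) / ?W t
      = (\<Sum>k\<le>s. c k / (of_real t - w) ^ Suc k) * cnj (\<Sum>k\<le>s. c k / (of_real t - w) ^ Suc k)" for t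
    unfolding ratio[symmetric] using tau_real_neq_0[of n a t] a
    by (simp add: h_def half_error_def cnj_tau del: power_Suc)
  also have "(\<Sum>k\<le>s. c k / (of_real t - w) ^ Suc k) * cnj (\<Sum>k\<le>s. c k / (of_real t - w) ^ Suc k)
      = (\<Sum>k\<le>s. \<Sum>l\<le>s. (c k * cnj (c l)) *
          (1 / ((of_real t - w) ^ Suc k * (of_real t - cnj w) ^ Suc l)))" for t :: real
    by (simp add: sum_product del: power_Suc)
  finally have cross_eq: "h t * cnj (h t) / ?W t
      = (\<Sum>k\<le>s. \<Sum>l\<le>s. (c k * cnj (c l)) *
          (1 / ((of_real t - w) ^ Suc k * (of_real t - cnj w) ^ Suc l)))" for t .
  let ?J = "\<Sum>k\<le>s. \<Sum>l\<le>s. (c k * cnj (c l)) *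
      (2 * pi * of_nat ((k + l) choose k) * \<i> ^ k * (- \<i>) ^ l / (2 * complex_of_real (Im w)) ^ Suc (k + l))"
  have cross: "has_bochner_integral lborel (\<lambda>t. h t * cnj (h t) / ?W t) ?J"
    unfolding cross_eq
    by (intro has_bochner_integral_sum has_bochner_integral_mult_right
        has_bochner_integral_conjugate_poles w)
  have "has_bochner_integral lborel
      (\<lambda>t. h t * h t / ?W t + cnj (h t * h t / ?W t)
        + (h t * cnj (h t) / ?W t + h t * cnj (h t) / ?W t))
      (0 + cnj 0 + (?J + ?J))"
    by (intro has_bochner_integral_add has_bochner_integral_cnj sq cross)
  moreover have "h t * h t / ?W t + cnj (h t * h t / ?W t)
        + (h t * cnj (h t) / ?W t + h t * cnj (h t) / ?W t)
      = (h t + cnj (h t)) * cnj (h t + cnj (h t)) / ?W t" for t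
    by (simp add: cnj_tau add_divide_distrib ring_distribs mult.commute)
  moreover have "0 + cnj 0 + (?J + ?J) = 4 * pi * (\<Sum>k\<le>s. \<Sum>l\<le>s. of_nat ((k + l) choose k)
      * (c k * \<i> ^ k) * cnj (c l * \<i> ^ l) / (2 * complex_of_real (Im w)) ^ Suc (k + l))"
    by (simp add: sum_distrib_left mult_2[symmetric] mult_ac del: power_Suc)
  ultimately show ?thesis by (simp only:)
qed

section \<open>The best approximant\<close>

lemma map_poly_cnj_mult: "map_poly cnj (p * q) = map_poly cnj p * map_poly cnj q"
  by (simp add: poly_eq_poly_eq_iff[symmetric] fun_eq_iff)

lemma dvd_map_poly_cnj: "p dvd q \<Longrightarrow> map_poly cnj p dvd map_poly cnj q"
  by (auto elim!: dvdE simp: map_poly_cnj_mult)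

text \<open>The cofactor of \<open>[:- x, 1:] ^ k\<close> keeps the full multiplicity of the root
  \<open>y\<close>, since that power does not vanish at \<open>y\<close>.\<close>

lemma linear_powers_mult_dvd:
  fixes p :: "'a :: field poly"
  assumes "x \<noteq> y" "[:- x, 1:] ^ k dvd p" "[:- y, 1:] ^ m dvd p"
  shows "[:- x, 1:] ^ k * [:- y, 1:] ^ m dvd p"
proof -
  obtain r where r: "p = [:- x, 1:] ^ k * r" using assms(2) by (auto elim: dvdE)
  have "[:- y, 1:] ^ m dvd r"
  proof (cases "r = 0")
    case False
    then have "order y p = order y ([:- x, 1:] ^ k) + order y r"
      unfolding r by (intro order_mult) simp
    moreover have "order y ([:- x, 1:] ^ k) = 0" using assms(1) by (intro order_0I) simp
    moreover have "p \<noteq> 0" using False r by simp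
    ultimately show ?thesis using assms(3) by (simp add: order_divides)
  qed simp
  then show ?thesis by (simp add: r)
qed

text \<open>The two principal parts of the approximand, at \<open>\<i>\<lambda>\<close> and at \<open>-\<i>\<lambda>\<close>, are removed by subtracting
  \<open>\<tau> r\<close> and its conjugate reflection, where \<open>r\<close> is the principal part of \<open>R\<close>; what is left is a
  polynomial.\<close>

lemma approximand_minus_half_errors:
  fixes A B lam :: real
  assumes lam: "lam > 0" and n: "n \<ge> 1" and N: "degree N \<le> s"
    and dvd: "[:- (\<i> * of_real lam), 1:] ^ Suc s dvd [:of_real A, of_real B:]
        - [:\<i> * of_real lam, 1:] ^ Suc s * root_poly n (\<lambda>k. cnj (a k)) * N"
  obtains p where "degree p \<le> n - 1"
    "\<And>t. approximand A B lam s (of_real t) - poly p (of_real t)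
      = half_error a n s (\<i> * of_real lam) N t + cnj (half_error a n s (\<i> * of_real lam) N t)"
proof -
  define u where "u = [:- (\<i> * complex_of_real lam), 1:]"
  define v where "v = [:\<i> * complex_of_real lam, 1:]"
  \<comment> \<open>Over the common denominator \<open>(z^2 + \<lambda>^2)^(s+1)\<close>, the two
    parts of the error have numerators \<open>K\<close> and \<open>K'\<close>, and \<open>M\<close>
    is what is left.\<close>
  define K where "K = v ^ Suc s * root_poly n (\<lambda>k. cnj (a k)) * N"
  define K' where "K' = map_poly cnj K"
  define M where "M = [:complex_of_real A, of_real B:] - K - K'"
  have cnj_power: "map_poly cnj (v ^ Suc s) = u ^ Suc s" "map_poly cnj (u ^ Suc s) = v ^ Suc s"
    by (simp_all add: u_def v_def poly_eq_poly_eq_iff[symmetric] fun_eq_iff add.commute del: power_Suc)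
  have "u ^ Suc s dvd K'"
    unfolding K'_def K_def cnj_power(1)[symmetric] by (intro dvd_map_poly_cnj) simp
  then have uM: "u ^ Suc s dvd M"
    using dvd unfolding M_def K_def u_def v_def by (rule dvd_diff[rotated])
  \<comment> \<open>Since \<open>A\<close> and \<open>B\<close> are real, conjugation carries the
    divisibility at \<open>\<i>\<lambda>\<close> over to \<open>-\<i>\<lambda>\<close>.\<close>
  have "map_poly cnj (u ^ Suc s) dvd map_poly cnj ([:of_real A, of_real B:] - K)"
    using dvd unfolding K_def u_def v_def by (rule dvd_map_poly_cnj)
  moreover have "map_poly cnj ([:of_real A, of_real B:] - K) = [:of_real A, of_real B:] - K'"
    by (simp add: K'_def poly_eq_poly_eq_iff[symmetric] fun_eq_iff)
  ultimately have "v ^ Suc s dvd [:of_real A, of_real B:] - K'"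
    by (simp only: cnj_power)
  moreover have "v ^ Suc s dvd K" by (simp add: K_def mult.assoc del: power_Suc)
  ultimately have "v ^ Suc s dvd [:of_real A, of_real B:] - K' - K"
    by (rule dvd_diff)
  then have vM: "v ^ Suc s dvd M" by (simp add: M_def algebra_simps)
  have "u ^ Suc s * v ^ Suc s dvd M"
    using linear_powers_mult_dvd[of "\<i> * of_real lam" "- (\<i> * of_real lam)" "Suc s" M "Suc s"] uM vM lam
    by (simp add: u_def v_def complex_eq_iff del: power_Suc)
  then obtain p where p: "M = u ^ Suc s * v ^ Suc s * p"
    by (auto elim: dvdE)
  have "degree p \<le> n - 1"
  proof (cases "p = 0")
    case False
    have "degree (root_poly n (\<lambda>k. cnj (a k)) * N) \<le> n + s"
      using degree_mult_le[of "root_poly n (\<lambda>k. cnj (a k))" N] N by simp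
    moreover have "degree (v ^ Suc s) = Suc s" by (simp add: v_def degree_power_eq del: power_Suc)
    ultimately have "degree K \<le> Suc s + (n + s)"
      unfolding K_def mult.assoc
      using degree_mult_le[of "v ^ Suc s" "root_poly n (\<lambda>k. cnj (a k)) * N"] by linarith
    \<comment> \<open>Removing the denominator of degree \<open>2 s + 2\<close> from degree at most
      \<open>n + 2 s + 1\<close> leaves \<open>n - 1\<close>.\<close>
    then have "degree M \<le> Suc s + (n + s)"
      unfolding M_def K'_def using n by (intro degree_diff_le) auto
    moreover have "degree M = Suc s + Suc s + degree p"
      unfolding p using False
      by (simp add: degree_mult_eq degree_power_eq u_def v_def del: power_Suc)
    ultimately show ?thesis by linarith
  qed simp
  moreover have "approximand A B lam s (of_real t) - poly p (of_real t)
      = half_error a n s (\<i> * of_real lam) N t + cnj (half_error a n s (\<i> * of_real lam) N t)" for t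
  proof -
    have nz: "of_real t - \<i> * of_real lam \<noteq> 0" "of_real t + \<i> * of_real lam \<noteq> 0"
      using lam by (auto simp: complex_eq_iff)
    define d where "d = ((of_real t)\<^sup>2 + (complex_of_real lam)\<^sup>2) ^ Suc s"
    have "(of_real t)\<^sup>2 + (complex_of_real lam)\<^sup>2 = (of_real t - \<i> * of_real lam) * (of_real t + \<i> * of_real lam)"
      by (simp add: power2_eq_square algebra_simps)
    then have d: "d = (of_real t - \<i> * of_real lam) ^ Suc s * (of_real t + \<i> * of_real lam) ^ Suc s"
      by (simp only: d_def power_mult_distrib)
    then have d0: "d \<noteq> 0" using nz by (simp only: no_zero_divisors power_not_zero not_False_eq_True)
    have cd: "cnj d = d" by (simp add: d_def)
    have K: "poly K (of_real t) / d = half_error a n s (\<i> * of_real lam) N t"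
      using nz by (simp add: d K_def v_def half_error_def add.commute[of "of_real t"] mult_ac del: power_Suc)
    then have K': "poly K' (of_real t) / d = cnj (half_error a n s (\<i> * of_real lam) N t)"
      unfolding K[symmetric] by (simp add: K'_def cd)
    have "poly M (of_real t) = d * poly p (of_real t)"
      unfolding p by (simp add: u_def v_def d add.commute[of "of_real t"] mult_ac del: power_Suc)
    then have "d * poly p (of_real t) = of_real A + of_real B * of_real t - poly K (of_real t) - poly K' (of_real t)"
      by (simp add: M_def mult.commute)
    then have "poly p (of_real t) = (of_real A + of_real B * of_real t) / d
        - poly K (of_real t) / d - poly K' (of_real t) / d"
      using d0 by (metis diff_divide_distrib nonzero_mult_div_cancel_left)
    then show ?thesis unfolding K K' by (simp add: approximand_def d_def)
  qed
  ultimately show thesis using that by blast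
qed


lemma cmod_rho_real:
  "(cmod (rho rho0 a n z))\<^sup>2 = (cmod rho0)\<^sup>2 * (cmod (tau n z a))\<^sup>2"
  by (simp add: rho_def tau_def norm_mult power_mult_distrib)

text \<open>Pythagoras: \<open>\<delta>\<close> is the squared norm of \<open>p - q\<close> in the weight \<open>1 / |\<tau>\<^sub>n|\<^sup>2\<close>.\<close>

lemma weighted_dist_decomposition:
  fixes A B lam :: real and rho0 w :: complex and p q N :: "complex poly"
    and a :: "nat \<Rightarrow> complex" and n s :: nat
  defines "e \<equiv> \<lambda>t. half_error a n s w N t + cnj (half_error a n s w N t)"
  assumes w: "Im w > 0" and N: "degree N \<le> s" and a: "\<And>k. k \<in> {1..n} \<Longrightarrow> Im (a k) > 0"
    and p: "degree p < n" and q: "degree q < n"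
    and diff: "\<And>t. approximand A B lam m (of_real t) - poly p (of_real t) = e t"
    and E: "has_bochner_integral lborel
      (\<lambda>t. e t * cnj (e t) / (tau n (of_real t) a * tau n (of_real t) (\<lambda>k. cnj (a k)))) E"
  obtains \<delta> where "\<delta> \<ge> 0" "q = p \<Longrightarrow> \<delta> = 0"
    "complex_of_real ((weighted_dist A B lam m rho0 a n q)\<^sup>2) = (E + of_real \<delta>) / of_real ((cmod rho0)\<^sup>2)"
proof -
  define d where "d = p - q"
  have d: "degree d < n" unfolding d_def using p q by (intro degree_diff_less)
  let ?W = "\<lambda>t. tau n (complex_of_real t) a * tau n (of_real t) (\<lambda>k. cnj (a k))"
  have W: "?W t = of_real ((cmod (tau n (of_real t) a))\<^sup>2)" for t
    by (rule cmod_tau_real[symmetric])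
  let ?D = "\<lambda>t. (cmod (poly d (of_real t)))\<^sup>2 / (cmod (tau n (of_real t) a))\<^sup>2"
  define \<delta> where "\<delta> = (\<integral>t. ?D t \<partial>lborel)"
  have D_eq: "complex_of_real (?D t) = poly (d * map_poly cnj d) (of_real t)
      / poly (root_poly n a * root_poly n (\<lambda>k. cnj (a k))) (of_real t)" for t
    by (simp only: of_real_divide W[symmetric] complex_norm_square poly_mult poly_root_poly
        poly_map_poly_cnj cnj_tau complex_cnj_complex_of_real)
  have "integrable lborel (\<lambda>t. complex_of_real (?D t))"
    unfolding D_eq
  proof (rule integrable_poly_quotient)
    have "degree (d * map_poly cnj d) \<le> degree d + degree d"
      using degree_mult_le[of d "map_poly cnj d"] by simp
    moreover have "degree (root_poly n a * root_poly n (\<lambda>k. cnj (a k))) = n + n"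
      by (simp add: degree_mult_eq root_poly_neq_0)
    ultimately show "degree (d * map_poly cnj d) + 2
        \<le> degree (root_poly n a * root_poly n (\<lambda>k. cnj (a k)))" using d by linarith
    show "poly (root_poly n a * root_poly n (\<lambda>k. cnj (a k))) (of_real t) \<noteq> 0" for t
      using tau_real_neq_0[of n a t] a by simp
  qed
  then have D: "has_bochner_integral lborel (\<lambda>t. complex_of_real (?D t)) (of_real \<delta>)"
    by (simp only: has_bochner_integral_iff \<delta>_def integral_complex_of_real)
  have O: "has_bochner_integral lborel (\<lambda>t. e t * cnj (poly d (of_real t)) / ?W t) 0"
    unfolding e_def using a w N d by (rule error_orthogonal)
  let ?g = "\<lambda>t. (cmod (approximand A B lam m (complex_of_real t) - poly q (complex_of_real t)))\<^sup>2
                / (cmod (rho rho0 a n (complex_of_real t)))\<^sup>2"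
  have "complex_of_real (?g t) = (e t * cnj (e t) / ?W t + e t * cnj (poly d (of_real t)) / ?W t
      + cnj (e t * cnj (poly d (of_real t)) / ?W t) + of_real (?D t)) / of_real ((cmod rho0)\<^sup>2)" for t
  proof -
    have f: "approximand A B lam m (of_real t) - poly q (of_real t) = e t + poly d (of_real t)"
      using diff[of t] by (simp add: d_def diff_eq_eq)
    have x: "of_real ((cmod x)\<^sup>2) = x * cnj x" for x by (rule complex_norm_square)
    have cW: "cnj (?W t) = ?W t" unfolding W by (rule complex_cnj_complex_of_real)
    have "complex_of_real (?g t) = (e t + poly d (of_real t)) * cnj (e t + poly d (of_real t))
        / ?W t / of_real ((cmod rho0)\<^sup>2)"
      unfolding f cmod_rho_real of_real_divide of_real_mult x W[symmetric]
      by (simp add: cnj_tau mult.commute)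
    also have "(e t + poly d (of_real t)) * cnj (e t + poly d (of_real t)) / ?W t
       = e t * cnj (e t) / ?W t + e t * cnj (poly d (of_real t)) / ?W t
      + cnj (e t * cnj (poly d (of_real t)) / ?W t) + of_real (?D t)"
      unfolding of_real_divide x complex_cnj_divide cW W[symmetric]
      by (simp add: cnj_tau add_divide_distrib ring_distribs mult.commute)
    finally show ?thesis .
  qed
  moreover have "has_bochner_integral lborel (\<lambda>t. (e t * cnj (e t) / ?W t + e t * cnj (poly d (of_real t)) / ?W t
      + cnj (e t * cnj (poly d (of_real t)) / ?W t) + of_real (?D t)) / of_real ((cmod rho0)\<^sup>2))
      ((E + 0 + cnj 0 + of_real \<delta>) / of_real ((cmod rho0)\<^sup>2))"
    by (intro has_bochner_integral_divide_zero has_bochner_integral_add has_bochner_integral_cnj E O D)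
  ultimately have "has_bochner_integral lborel (\<lambda>t. complex_of_real (?g t))
      ((E + of_real \<delta>) / of_real ((cmod rho0)\<^sup>2))"
    by (simp only: complex_cnj_zero add_0_right)
  then have "complex_of_real (\<integral>t. ?g t \<partial>lborel) = (E + of_real \<delta>) / of_real ((cmod rho0)\<^sup>2)"
    by (simp only: has_bochner_integral_iff integral_complex_of_real)
  moreover have "(weighted_dist A B lam m rho0 a n q)\<^sup>2 = (\<integral>t. ?g t \<partial>lborel)"
    unfolding weighted_dist_def by (rule real_sqrt_pow2) (intro integral_nonneg_AE AE_I2, simp)
  moreover have "\<delta> \<ge> 0" unfolding \<delta>_def by (intro integral_nonneg_AE AE_I2) simp
  moreover have "\<delta> = 0" if "q = p" using that by (simp add: \<delta>_def d_def)
  ultimately show thesis using that by simp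
qed


text \<open>On the real line \<open>f\<close> is \<open>p / tau\<close> plus an error orthogonal to
  every \<open>Phi\<close>, and \<open>p / tau\<close> lies in their span, so the Fourier sum
  reproduces it.\<close>

lemma fourier_sum_eq:
  fixes p N :: "complex poly" and a :: "nat \<Rightarrow> complex" and n s :: nat and w :: complex
  defines "e \<equiv> \<lambda>t. half_error a n s w N t + cnj (half_error a n s w N t)"
  assumes a: "\<And>k. k \<ge> 1 \<Longrightarrow> Im (a k) > 0" and w: "Im w > 0" and N: "degree N \<le> s"
    and p: "degree p < n"
    and f: "\<And>t. f (of_real t) * tau n (of_real t) (\<lambda>k. cnj (a k)) = poly p (of_real t) + e t"
    and z: "tau n z (\<lambda>k. cnj (a k)) \<noteq> 0"
  shows "fourier_sum a n f z = poly p z / tau n z (\<lambda>k. cnj (a k))"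
proof -
  obtain c where c: "\<And>z. tau n z (\<lambda>k. cnj (a k)) \<noteq> 0 \<Longrightarrow>
      poly p z / tau n z (\<lambda>k. cnj (a k)) = (\<Sum>j=1..n. c j * Phi a j z)"
    using Phi_span[of a p n] a p by metis
  have nz: "tau n (of_real t) a \<noteq> 0" "tau n (of_real t) (\<lambda>k. cnj (a k)) \<noteq> 0" for t
    using a tau_real_neq_0[of n a] by auto
  have coeff: "(\<integral>t. f (of_real t) * cnj (Phi a j (of_real t)) \<partial>lborel) = c j * pi" if j: "j \<in> {1..n}" for j
  proof -
    obtain D where D: "degree D < n" "\<And>z. tau n z (\<lambda>k. cnj (a k)) \<noteq> 0 \<Longrightarrow>
        Phi a j z = poly D z / tau n z (\<lambda>k. cnj (a k))"
      using Phi_numerator[OF j] by blast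
    have "f (of_real t) * cnj (Phi a j (of_real t))
        = e t * cnj (poly D (of_real t)) / (tau n (of_real t) a * tau n (of_real t) (\<lambda>k. cnj (a k)))
          + (\<Sum>i=1..n. c i * (Phi a i (of_real t) * cnj (Phi a j (of_real t))))" for t
    proof -
      have "f (of_real t) = e t / tau n (of_real t) (\<lambda>k. cnj (a k))
          + poly p (of_real t) / tau n (of_real t) (\<lambda>k. cnj (a k))"
        using f[of t] nz[of t] by (simp add: field_simps)
      also have "\<dots> = e t / tau n (of_real t) (\<lambda>k. cnj (a k)) + (\<Sum>i=1..n. c i * Phi a i (of_real t))"
        by (simp only: c[OF nz(2)])
      finally have "f (of_real t) * cnj (Phi a j (of_real t))
          = e t / tau n (of_real t) (\<lambda>k. cnj (a k)) * cnj (Phi a j (of_real t))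
            + (\<Sum>i=1..n. c i * Phi a i (of_real t)) * cnj (Phi a j (of_real t))"
        by (simp only: ring_distribs)
      moreover have "cnj (Phi a j (of_real t)) = cnj (poly D (of_real t)) / tau n (of_real t) a"
        using nz[of t] by (simp add: D(2) cnj_tau)
      ultimately show ?thesis by (simp add: sum_distrib_right sum_distrib_left mult_ac)
    qed
    moreover have "has_bochner_integral lborel (\<lambda>t. e t * cnj (poly D (of_real t))
        / (tau n (of_real t) a * tau n (of_real t) (\<lambda>k. cnj (a k)))
          + (\<Sum>i=1..n. c i * (Phi a i (of_real t) * cnj (Phi a j (of_real t)))))
        (0 + (\<Sum>i=1..n. c i * (if i = j then of_real pi else 0)))"
    proof (intro has_bochner_integral_add has_bochner_integral_sum has_bochner_integral_mult_right)
      show "has_bochner_integral lborel (\<lambda>t. e t * cnj (poly D (of_real t))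
          / (tau n (of_real t) a * tau n (of_real t) (\<lambda>k. cnj (a k)))) 0"
        unfolding e_def using a w N D(1) by (intro error_orthogonal) auto
      show "has_bochner_integral lborel (\<lambda>t. Phi a i (of_real t) * cnj (Phi a j (of_real t)))
          (if i = j then of_real pi else 0)" if "i \<in> {1..n}" for i
        using that j by (intro Phi_orthonormal a) auto
    qed
    moreover have "(\<Sum>i=1..n. c i * (if i = j then of_real pi else 0)) = c j * pi"
      using j by (simp add: if_distrib[of "\<lambda>x. _ * x"] cong: if_cong)
    ultimately show ?thesis by (simp only: add_0_left has_bochner_integral_iff)
  qed
  have "fourier_sum a n f z = (\<Sum>j=1..n. c j * Phi a j z)"
    unfolding fourier_sum_def by (intro sum.cong refl) (simp only: coeff, simp)
  then show ?thesis using c[OF z] by simp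
qed

theorem theorem3p2:
  fixes A B lam :: real and s n :: nat and a :: "nat \<Rightarrow> complex" and rho0 :: complex
  assumes "lam > 0" and "s \<ge> 1" and "n \<ge> 1"
    and "\<And>k. k \<ge> 1 \<Longrightarrow> Im (a k) > 0"
    and "rho0 \<noteq> 0"
  shows "complex_of_real ((best_approx A B lam s rho0 a n)\<^sup>2) =
           of_real (4 * pi / ((2 * lam) ^ (2 * s + 3) * (cmod (rho rho0 a n (- (\<i> * of_real lam))))\<^sup>2))
             * (\<Sum>k=0..s. \<Sum>l=0..s.
                  of_nat ((l + k) choose l) * G A B lam s a n k * cnj (G A B lam s a n l))
       \<and> (\<exists>p \<in> polys (n - 1).
            (\<forall>z. z \<notin> (\<lambda>k. cnj (a k)) ` {1..n} \<longrightarrow>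
               poly p z = tau n z (\<lambda>k. cnj (a k)) * fourier_sum a n (R A B lam s a n) z)
          \<and> weighted_dist A B lam s rho0 a n p = best_approx A B lam s rho0 a n)"
proof -
  define L where "L = complex_of_real lam"
  define w where "w = \<i> * L"
  have w: "Im w > 0" "Im w = lam" using assms(1) by (simp_all add: w_def L_def)
  have L: "L \<noteq> 0" using assms(1) by (simp add: L_def)
  define T where "T = tau n w (\<lambda>j. cnj (a j))"
  have ne: "w \<noteq> cnj (a j)" if "j \<in> {1..n}" for j
    using assms(4)[of j] w that by (auto simp: complex_eq_iff)
  then have T0: "T \<noteq> 0" unfolding T_def tau_eq_0_iff by blast
  obtain c where
    c: "\<And>k. k \<le> s \<Longrightarrow> G A B lam s a n k = (2 * L) ^ Suc s * T * (c k * \<i> ^ k / (2 * L) ^ k)"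
    and dvd: "[:- (\<i> * of_real lam), 1:] ^ Suc s dvd [:of_real A, of_real B:]
        - [:\<i> * of_real lam, 1:] ^ Suc s * (\<Prod>j=1..n. [:- cnj (a j), 1:])
          * (\<Sum>k\<le>s. smult (c k) ([:- (\<i> * of_real lam), 1:] ^ (s - k)))"
  proof (rule G_principal_part[where A = A and B = B and lam = lam and s = s and n = n and a = a])
    show "\<i> * complex_of_real lam \<noteq> cnj (a j)" if "j \<in> {1..n}" for j
      using ne[OF that] by (simp only: w_def L_def not_False_eq_True)
  qed (use assms(1,2) that in \<open>simp_all only: L_def w_def T_def\<close>)
  define N where "N = (\<Sum>k\<le>s. smult (c k) ([:- w, 1:] ^ (s - k)))"
  have N: "degree N \<le> s"
    unfolding N_def
    by (intro degree_sum_le) (auto intro!: order_trans[OF degree_smult_le] simp: degree_power_eq)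
  define e where "e t = half_error a n s w N t + cnj (half_error a n s w N t)" for t
  obtain p where p: "degree p \<le> n - 1"
    and e: "\<And>t. approximand A B lam s (of_real t) - poly p (of_real t) = e t"
  proof (rule approximand_minus_half_errors[OF assms(1,3) N, of A B a])
    show "[:- (\<i> * of_real lam), 1:] ^ Suc s dvd [:of_real A, of_real B:]
        - [:\<i> * of_real lam, 1:] ^ Suc s * root_poly n (\<lambda>k. cnj (a k)) * N"
      using dvd by (simp only: N_def root_poly_def w_def L_def)
  qed (use that in \<open>simp only: e_def w_def L_def\<close>)
  have pn: "degree p < n" using p assms(3) by simp
  have a: "\<And>k. k \<in> {1..n} \<Longrightarrow> Im (a k) > 0" using assms(4) by simp
  \<comment> \<open>The squared norm of the error in the weight \<open>1 / |tau|^2\<close>, before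
    division by \<open>|rho0|^2\<close>.\<close>
  define E where "E = 4 * pi * (\<Sum>k\<le>s. \<Sum>l\<le>s. of_nat ((k + l) choose k)
      * (c k * \<i> ^ k) * cnj (c l * \<i> ^ l) / (2 * complex_of_real (Im w)) ^ Suc (k + l))"
  have E: "has_bochner_integral lborel (\<lambda>t. (half_error a n s w N t + cnj (half_error a n s w N t))
      * cnj (half_error a n s w N t + cnj (half_error a n s w N t))
      / (tau n (of_real t) a * tau n (of_real t) (\<lambda>k. cnj (a k)))) E"
    unfolding E_def using a w(1) N N_def by (rule half_error_norm)
  let ?d = "weighted_dist A B lam s rho0 a n"
  have dist: "\<exists>\<delta>\<ge>0. (q = p \<longrightarrow> \<delta> = 0) \<and>
      complex_of_real ((?d q)\<^sup>2) = (E + of_real \<delta>) / of_real ((cmod rho0)\<^sup>2)" if "degree q < n" for q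
    using weighted_dist_decomposition[where q = q, OF w(1) N _ pn that e[unfolded e_def] E] a by metis
  have dp: "complex_of_real ((?d p)\<^sup>2) = E / of_real ((cmod rho0)\<^sup>2)"
    using dist[OF pn] by auto
  have nonneg: "?d q \<ge> 0" for q
    unfolding weighted_dist_def by (intro real_sqrt_ge_zero integral_nonneg_AE AE_I2) simp
  have min: "?d p \<le> ?d q" if q: "degree q < n" for q
  proof -
    obtain \<delta> where \<delta>: "\<delta> \<ge> 0" "complex_of_real ((?d q)\<^sup>2) = (E + of_real \<delta>) / of_real ((cmod rho0)\<^sup>2)"
      using dist[OF q] by blast
    then have "complex_of_real ((?d q)\<^sup>2) = of_real ((?d p)\<^sup>2 + \<delta> / (cmod rho0)\<^sup>2)"
      unfolding of_real_add dp by (simp add: add_divide_distrib)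
    then have "(?d q)\<^sup>2 = (?d p)\<^sup>2 + \<delta> / (cmod rho0)\<^sup>2" by (simp only: of_real_eq_iff)
    then have "(?d p)\<^sup>2 \<le> (?d q)\<^sup>2" using \<delta>(1) by simp
    then show ?thesis using nonneg by (rule power2_le_imp_le)
  qed
  have best: "best_approx A B lam s rho0 a n = ?d p"
    unfolding best_approx_def
  proof (rule antisym)
    show "(INF q\<in>polys (n - 1). ?d q) \<le> ?d p"
      using p nonneg by (intro cINF_lower bdd_belowI2[of _ 0]) (auto simp: polys_def)
    show "?d p \<le> (INF q\<in>polys (n - 1). ?d q)"
      using p min assms(3) by (intro cINF_greatest) (auto simp: polys_def)
  qed
  \<comment> \<open>Here \<open>- w = cnj w\<close>, so \<open>tau n (- w) a\<close> is the
    conjugate of \<open>T\<close>.\<close>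
  have rhoT: "(cmod (rho rho0 a n (- w)))\<^sup>2 = (cmod rho0)\<^sup>2 * (cmod T)\<^sup>2"
  proof -
    have "cmod T = cmod (cnj T)" by simp
    also have "cnj T = tau n (- w) a" by (simp add: T_def cnj_tau w_def L_def)
    finally show ?thesis by (simp only: cmod_rho_real)
  qed
  have summand: "of_real (4 * pi / ((2 * lam) ^ (2 * s + 3) * ((cmod rho0)\<^sup>2 * (cmod T)\<^sup>2)))
      * (of_nat ((l + k) choose l) * G A B lam s a n k * cnj (G A B lam s a n l))
      = 4 * pi * (of_nat ((k + l) choose k) * (c k * \<i> ^ k) * cnj (c l * \<i> ^ l)
        / (2 * complex_of_real (Im w)) ^ Suc (k + l)) / of_real ((cmod rho0)\<^sup>2)"
    if "k \<le> s" "l \<le> s" for k l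
  proof -
    define x where "x = c k * \<i> ^ k"
    define y where "y = c l * \<i> ^ l"
    define \<mu> where "\<mu> = 2 * L"
    have \<mu>: "\<mu> \<noteq> 0" "cnj \<mu> = \<mu>" "of_real (2 * lam) = \<mu>" "2 * complex_of_real (Im w) = \<mu>"
      using L w(2) by (simp_all add: \<mu>_def L_def)
    have ch: "(l + k) choose l = (k + l) choose k"
      by (metis add.commute add_diff_cancel_right' binomial_symmetric le_add1)
    have TT: "of_real ((cmod T)\<^sup>2) = T * cnj T" by (rule complex_norm_square)
    \<comment> \<open>Each of the two \<open>G\<close> carries a factor
      \<open>\<mu> ^ Suc s\<close>; the extra \<open>\<mu>\<close> goes into the exponent
      \<open>Suc (k + l)\<close>.\<close>
    have "2 * s + 3 = Suc s + Suc s + 1" by simp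
    then have pw: "\<mu> ^ (2 * s + 3) = \<mu> ^ Suc s * \<mu> ^ Suc s * \<mu>"
      by (simp only: power_add power_one_right)
    have "of_real (4 * pi / ((2 * lam) ^ (2 * s + 3) * ((cmod rho0)\<^sup>2 * (cmod T)\<^sup>2)))
      * (of_nat ((l + k) choose l) * G A B lam s a n k * cnj (G A B lam s a n l))
      = 4 * pi / (\<mu> ^ Suc s * \<mu> ^ Suc s * \<mu> * (of_real ((cmod rho0)\<^sup>2) * (T * cnj T)))
      * (of_nat ((k + l) choose k) * (\<mu> ^ Suc s * T * (x / \<mu> ^ k)) * (\<mu> ^ Suc s * cnj T * (cnj y / \<mu> ^ l)))"
      unfolding c[OF that(1)] c[OF that(2)] ch of_real_divide of_real_mult of_real_power[of _ "2 * s + 3"]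
        \<mu>(3)[unfolded of_real_mult] pw TT x_def[symmetric] y_def[symmetric] \<mu>_def[symmetric]
      by (simp add: \<mu>(2) del: power_Suc)
    also have "\<dots> = 4 * pi * (of_nat ((k + l) choose k) * x * cnj y / (\<mu> * \<mu> ^ k * \<mu> ^ l))
        / of_real ((cmod rho0)\<^sup>2)"
      using \<mu>(1) T0 by (simp add: mult_ac del: power_Suc)
    also have "\<mu> * \<mu> ^ k * \<mu> ^ l = \<mu> ^ Suc (k + l)" by (simp add: power_add)
    finally show ?thesis unfolding \<mu>(4) x_def y_def .
  qed
  have "of_real (4 * pi / ((2 * lam) ^ (2 * s + 3) * (cmod (rho rho0 a n (- (\<i> * of_real lam))))\<^sup>2))
      * (\<Sum>k=0..s. \<Sum>l=0..s.
           of_nat ((l + k) choose l) * G A B lam s a n k * cnj (G A B lam s a n l))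
      = (\<Sum>k\<le>s. \<Sum>l\<le>s. 4 * pi * (of_nat ((k + l) choose k) * (c k * \<i> ^ k) * cnj (c l * \<i> ^ l)
        / (2 * complex_of_real (Im w)) ^ Suc (k + l)) / of_real ((cmod rho0)\<^sup>2))"
    unfolding L_def[symmetric] w_def[symmetric] rhoT sum_distrib_left atMost_atLeast0
    by (intro sum.cong refl summand) auto
  also have "\<dots> = E / of_real ((cmod rho0)\<^sup>2)"
    unfolding E_def sum_distrib_left sum_divide_distrib ..
  finally have part1: "complex_of_real ((best_approx A B lam s rho0 a n)\<^sup>2) =
           of_real (4 * pi / ((2 * lam) ^ (2 * s + 3) * (cmod (rho rho0 a n (- (\<i> * of_real lam))))\<^sup>2))
             * (\<Sum>k=0..s. \<Sum>l=0..s.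
                  of_nat ((l + k) choose l) * G A B lam s a n k * cnj (G A B lam s a n l))"
    unfolding best dp by (rule sym)
  \<comment> \<open>The points \<open>cnj (a k)\<close> are excluded because division by zero there
    gives the Fourier sum default values.\<close>
  have "poly p z = tau n z (\<lambda>k. cnj (a k)) * fourier_sum a n (R A B lam s a n) z"
    if "z \<notin> (\<lambda>k. cnj (a k)) ` {1..n}" for z
  proof -
    have z: "tau n z (\<lambda>k. cnj (a k)) \<noteq> 0" using that by (simp add: tau_eq_0_iff)
    have "fourier_sum a n (R A B lam s a n) z = poly p z / tau n z (\<lambda>k. cnj (a k))"
    proof (rule fourier_sum_eq[OF _ w(1) N pn _ z])
      fix t :: real
      have "R A B lam s a n (of_real t) * tau n (of_real t) (\<lambda>k. cnj (a k)) = approximand A B lam s (of_real t)"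
        using tau_real_neq_0[of n a t] a by (simp add: R_def approximand_def)
      then show "R A B lam s a n (of_real t) * tau n (of_real t) (\<lambda>k. cnj (a k))
          = poly p (of_real t) + (half_error a n s w N t + cnj (half_error a n s w N t))"
        using e[of t] by (simp add: e_def algebra_simps)
    qed (use assms(4) in simp)
    then show ?thesis using z by simp
  qed
  then show ?thesis using part1 p best by (auto simp: polys_def)
qed

end
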